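(* Let $\mathbf{X}=(X_1,\ldots,X_N)^\intercal$ satisfy the standing assumptions (1)-(3) listed in the context, let $\mathbf{p}\in\mathbb{N}_0^N$, let $\boldsymbol{\Xi}=\{\boldsymbol{\xi}_1,\ldots,\boldsymbol{\xi}_N\}$ with $\boldsymbol{\xi}_k$ a $(p_k+1)$-open knot sequence on $[a_k,b_k]$, and let $y(\mathbf{X})\in L^2(\Omega,\mathcal{F},\mathbb{P})$. The SDD approximation $y_{\mathbf{p},\boldsymbol{\Xi}}(\mathbf{X})$ is the best approximation of $y(\mathbf{X})$ from $\mathcal{S}_{\mathbf{p},\boldsymbol{\Xi}}$ in the sense that \[ \mathbb{E}\left[\left(y(\mathbf{X})-y_{\mathbf{p},\boldsymbol{\Xi}}(\mathbf{X})\right)^2\right]=\inf_{g\in\mathcal{S}_{\mathbf{p},\boldsymbol{\Xi}}}\mathbb{E}\left[\left(y(\mathbf{X})-g(\mathbf{X})\right)^2\right] \] or, equivalently, \[ \left\|y-y_{\mathbf{p},\boldsymbol{\Xi}}\right\|_{L^2(\mathbb{A}^N,\mathcal{B}^N,f_{\mathbf{X}}d\mathbf{x})}=\inf_{g\in\mathcal{S}_{\mathbf{p},\boldsymbol{\Xi}}}\left\|y-g\right\|_{L^2(\mathbb{A}^N,\mathcal{B}^N,f_{\mathbf{X}}d\mathbf{x})}. \]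
   Context: Notation: $\mathbb{N}=\{1,2,\ldots\}$, $\mathbb{N}_0=\mathbb{N}\cup\{0\}$. $(\Omega,\mathcal{F},\mathbb{P})$ is a probability space with expectation $\mathbb{E}$; for $k=1,\ldots,N$ ($N\in\mathbb{N}$), $[a_k,b_k]\subset\mathbb{R}$ is a finite interval with $a_k<b_k$; $\mathbb{A}^N=\prod_{k=1}^N[a_k,b_k]$ with Borel $\sigma$-algebra $\mathcal{B}^N$; $\mathbf{X}:(\Omega,\mathcal{F})\to(\mathbb{A}^N,\mathcal{B}^N)$. Standing assumptions on $\mathbf{X}$: (1) $X_1,\ldots,X_N$ are statistically independent, not necessarily identically distributed. (2) Each $X_k$ is defined on the bounded interval $[a_k,b_k]$, hence has finite moments of all orders. (3) Each $X_k$ has an absolutely continuous marginal distribution function and a continuous marginal probability density function $f_{X_k}$ with bounded support $[a_k,b_k]$. Hence $\mathbf{X}$ has joint density $f_{\mathbf{X}}(\mathbf{x})=\prod_{k=1}^N f_{X_k}(x_k)$ supported on $\mathbb{A}^N$. For $\emptyset\neq u=\{k_1,\ldots,k_{|u|}\}\subseteq\{1,\ldots,N\}$: $\mathbf{X}_u=(X_{k_1},\ldots,X_{k_{|u|}})^\intercal$, $\mathbf{x}_u=(x_{k_1},\ldots,x_{k_{|u|}})$, $\mathbf{p}_u=(p_k)_{k\in u}$, $\boldsymbol{\Xi}_u=\{\boldsymbol{\xi}_k\}_{k\in u}$, $\mathbf{n}_u=(n_k)_{k\in u}$. Knots: for $n_k>p_k\ge0$, a $(p_k+1)$-open knot sequence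 on $[a_k,b_k]$ is a non-decreasing sequence $\boldsymbol{\xi}_k=\{\xi_{k,i}\}_{i=1}^{n_k+p_k+1}$ with distinct values $a_k=\zeta_{k,1}<\cdots<\zeta_{k,r_k}=b_k$ of multiplicities $m_{k,1}=m_{k,r_k}=p_k+1$ and $1\le m_{k,j}\le p_k+1$ for $1<j<r_k$. B-splines: $B^k_{i,0,\boldsymbol{\xi}_k}(x)=1$ if $\xi_{k,i}\le x<\xi_{k,i+1}$ and $0$ otherwise; for $p\ge1$, $B^k_{i,p,\boldsymbol{\xi}_k}(x)=\frac{x-\xi_{k,i}}{\xi_{k,i+p}-\xi_{k,i}}B^k_{i,p-1,\boldsymbol{\xi}_k}(x)+\frac{\xi_{k,i+p+1}-x}{\xi_{k,i+p+1}-\xi_{k,i+1}}B^k_{i+1,p-1,\boldsymbol{\xi}_k}(x)$, with $0/0:=0$. The univariate spline space is $\mathcal{S}_{k,p_k,\boldsymbol{\xi}_k}=\operatorname{span}\{B^k_{i,p_k,\boldsymbol{\xi}_k}:1\le i\le n_k\}$, of dimension $n_k$. Functions equal almost everywhere are identified. The tensor-product spline space is $\mathcal{S}_{\mathbf{p},\boldsymbol{\Xi}}=\bigotimes_{k=1}^N\mathcal{S}_{k,p_k,\boldsymbol{\xi}_k}$. Orthonormalized B-splines: let $\mathbf{P}_k(x_k)=(1,B^k_{2,p_k,\boldsymbol{\xi}_k}(x_k),\ldots,B^k_{n_k,p_k,\boldsymbol{\xi}_k}(x_k))^\intercal$, let $\mathbf{G}_k=\mathbb{E}[\mathbf{P}_k(X_k)\mathbf{P}_k^\intercal(X_k)]$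 (symmetric positive-definite), with Cholesky factorization $\mathbf{G}_k=\mathbf{Q}_k\mathbf{Q}_k^\intercal$, $\mathbf{Q}_k$ lower-triangular with positive diagonal. Then $\boldsymbol{\psi}_k(x_k)=\mathbf{Q}_k^{-1}\mathbf{P}_k(x_k)$ has components $\psi^k_{i,p_k,\boldsymbol{\xi}_k}(x_k)$, $i=1,\ldots,n_k$. Multivariate splines: $\bar{\mathcal{I}}_{u,\mathbf{n}_u}=\{\mathbf{i}_u=(i_{k_1},\ldots,i_{k_{|u|}}):2\le i_{k_l}\le n_{k_l},\ 1\le l\le|u|\}$ and $\Psi^u_{\mathbf{i}_u,\mathbf{p}_u,\boldsymbol{\Xi}_u}(\mathbf{x}_u)=\prod_{k\in u}\psi^k_{i_k,p_k,\boldsymbol{\xi}_k}(x_k)$. $L^2(\mathbb{A}^N,\mathcal{B}^N,f_{\mathbf{X}}d\mathbf{x})$ is the space of real functions $y$ with $\int_{\mathbb{A}^N}|y|^2f_{\mathbf{X}}d\mathbf{x}<\infty$; here $L^2(\Omega,\mathcal{F},\mathbb{P})$ denotes the corresponding Hilbert space of square-integrable random variables of the form $y(\mathbf{X})$. SDD approximation of $y(\mathbf{X})\in L^2(\Omega,\mathcal{F},\mathbb{P})$: $y_{\mathbf{p},\boldsymbol{\Xi}}(\mathbf{X})=y_\emptyset+\sum_{\emptyset\neq u\subseteq\{1,\ldots,N\}}\sum_{\mathbf{i}_u\in\bar{\mathcal{I}}_{u,\mathbf{n}_u}}C^u_{\mathbf{i}_u,\mathbf{p}_u,\boldsymbol{\Xi}_u}\Psi^u_{\mathbf{i}_u,\mathbf{p}_u,\boldsymbol{\Xi}_u}(\mathbf{X}_u)$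 with $y_\emptyset=\mathbb{E}[y(\mathbf{X})]$ and $C^u_{\mathbf{i}_u,\mathbf{p}_u,\boldsymbol{\Xi}_u}=\mathbb{E}[y(\mathbf{X})\Psi^u_{\mathbf{i}_u,\mathbf{p}_u,\boldsymbol{\Xi}_u}(\mathbf{X}_u)]$. *)

theory Defs
  imports
    "HOL-Probability.Probability"
    "HOL-Library.Function_Algebras"
    "Jordan_Normal_Form.Gauss_Jordan_Elimination"
begin

no_notation Matrix.vec_index (infixl "$" 100)

section \<open>Function spaces\<close>

interpretation fun_space: vector_space "\<lambda>(c::real) (f::'a \<Rightarrow> real) x. c * f x"
  by unfold_locales (auto simp: fun_eq_iff algebra_simps)

section \<open>Knots, B-splines and spline spaces\<close>

definition knot_mult :: "nat \<Rightarrow> (nat \<Rightarrow> real) \<Rightarrow> real \<Rightarrow> nat" where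
  "knot_mult l \<xi> z = card {i \<in> {1..l}. \<xi> i = z}"

text \<open>Knots carry the indices \<open>1, \<dots>, n + p + 1\<close>; the values of \<open>\<xi>\<close> at other indices are irrelevant.\<close>

definition open_knots :: "real \<Rightarrow> real \<Rightarrow> nat \<Rightarrow> nat \<Rightarrow> (nat \<Rightarrow> real) \<Rightarrow> bool" where
  "open_knots a b p n \<xi> \<longleftrightarrow>
     p < n \<and> mono_on {1..n + p + 1} \<xi> \<and>
     \<xi> 1 = a \<and> \<xi> (n + p + 1) = b \<and>
     knot_mult (n + p + 1) \<xi> a = p + 1 \<and> knot_mult (n + p + 1) \<xi> b = p + 1 \<and>
     (\<forall>z \<in> \<xi> ` {1..n + p + 1}. knot_mult (n + p + 1) \<xi> z \<le> p + 1)"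

text \<open>
  The convention \<open>0/0 := 0\<close> is covered by \<open>x / 0 = 0\<close>: when a denominator vanishes, so does the
  B-spline of lower degree it is multiplied with. All B-splines vanish at the right end point \<open>b\<close>,
  so \<open>\<Sum>i=1..n. bspline \<xi> p i x = 1\<close> holds on \<open>{a..<b}\<close> only: constants belong to the spline space
  only up to null sets.
\<close>

primrec bspline :: "(nat \<Rightarrow> real) \<Rightarrow> nat \<Rightarrow> nat \<Rightarrow> real \<Rightarrow> real" where
  "bspline \<xi> 0 i x = (if \<xi> i \<le> x \<and> x < \<xi> (i + 1) then 1 else 0)"
| "bspline \<xi> (Suc p) i x =
     (x - \<xi> i) / (\<xi> (i + Suc p) - \<xi> i) * bspline \<xi> p i x +
     (\<xi> (i + Suc p + 1) - x) / (\<xi> (i + Suc p + 1) - \<xi> (i + 1)) * bspline \<xi> p (i + 1) x"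

definition spline_space :: "nat \<Rightarrow> nat \<Rightarrow> (nat \<Rightarrow> real) \<Rightarrow> (real \<Rightarrow> real) set" where
  "spline_space p n \<xi> = fun_space.span ((\<lambda>i. bspline \<xi> p i) ` {1..n})"

text \<open>
  The tensor product of spaces of univariate functions, realized as the span of the elementary
  tensors \<open>x \<mapsto> g\<^sub>1(x\<^sub>1) \<cdots> g\<^sub>N(x\<^sub>N)\<close>.
\<close>

definition tensor_spline_space ::
    "('n::finite \<Rightarrow> nat) \<Rightarrow> ('n \<Rightarrow> nat) \<Rightarrow> ('n \<Rightarrow> nat \<Rightarrow> real) \<Rightarrow> (real^'n \<Rightarrow> real) set" where
  "tensor_spline_space p n \<xi> =
     fun_space.span {\<lambda>x. \<Prod>k\<in>UNIV. g k (x $ k) | g. \<forall>k. g k \<in> spline_space (p k) (n k) (\<xi> k)}"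

section \<open>Orthonormalized B-splines\<close>

text \<open>
  Vectors and matrices are indexed from \<open>0\<close>, so the entry at position \<open>i\<close> belongs to the
  B-spline with number \<open>i + 1\<close>.
\<close>

definition spline_vec :: "nat \<Rightarrow> nat \<Rightarrow> (nat \<Rightarrow> real) \<Rightarrow> real \<Rightarrow> real Matrix.vec" where
  "spline_vec p n \<xi> x = Matrix.vec n (\<lambda>i. if i = 0 then 1 else bspline \<xi> p (i + 1) x)"

definition spline_gram ::
    "'w measure \<Rightarrow> ('w \<Rightarrow> real) \<Rightarrow> nat \<Rightarrow> nat \<Rightarrow> (nat \<Rightarrow> real) \<Rightarrow> real Matrix.mat" where
  "spline_gram M Z p n \<xi> = Matrix.mat n n (\<lambda>(i, j).
     integral\<^sup>L M (\<lambda>\<omega>. vec_index (spline_vec p n \<xi> (Z \<omega>)) i * vec_index (spline_vec p n \<xi> (Z \<omega>)) j))"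

text \<open>The Cholesky factor of a symmetric positive-definite matrix is unique, so the choice below is determined.\<close>

definition cholesky_factor :: "real Matrix.mat \<Rightarrow> real Matrix.mat" where
  "cholesky_factor G = (SOME Q. Q \<in> carrier_mat (dim_row G) (dim_row G) \<and>
     upper_triangular (transpose_mat Q) \<and> (\<forall>i < dim_row Q. Q $$ (i, i) > 0) \<and>
     G = Q * transpose_mat Q)"

definition orthonormal_spline ::
    "'w measure \<Rightarrow> ('w \<Rightarrow> real) \<Rightarrow> nat \<Rightarrow> nat \<Rightarrow> (nat \<Rightarrow> real) \<Rightarrow> nat \<Rightarrow> real \<Rightarrow> real" where
  "orthonormal_spline M Z p n \<xi> i x =
     vec_index (the (mat_inverse (cholesky_factor (spline_gram M Z p n \<xi>))) *\<^sub>v spline_vec p n \<xi> x)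
       (i - 1)"

section \<open>The spline dimensional decomposition\<close>

text \<open>Multi-indices over \<open>u\<close> are functions that are \<open>undefined\<close> outside \<open>u\<close>, so each is counted once.\<close>

definition sdd_indices :: "('n \<Rightarrow> nat) \<Rightarrow> 'n set \<Rightarrow> ('n \<Rightarrow> nat) set" where
  "sdd_indices n u = (\<Pi>\<^sub>E k\<in>u. {2..n k})"

definition sdd_basis ::
    "'w measure \<Rightarrow> ('w \<Rightarrow> real^'n) \<Rightarrow> ('n::finite \<Rightarrow> nat) \<Rightarrow> ('n \<Rightarrow> nat) \<Rightarrow> ('n \<Rightarrow> nat \<Rightarrow> real) \<Rightarrow>
     'n set \<Rightarrow> ('n \<Rightarrow> nat) \<Rightarrow> real^'n \<Rightarrow> real" where
  "sdd_basis M X p n \<xi> u i x =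
     (\<Prod>k\<in>u. orthonormal_spline M (\<lambda>\<omega>. X \<omega> $ k) (p k) (n k) (\<xi> k) (i k) (x $ k))"

definition sdd_coeff ::
    "'w measure \<Rightarrow> ('w \<Rightarrow> real^'n) \<Rightarrow> ('n::finite \<Rightarrow> nat) \<Rightarrow> ('n \<Rightarrow> nat) \<Rightarrow> ('n \<Rightarrow> nat \<Rightarrow> real) \<Rightarrow>
     (real^'n \<Rightarrow> real) \<Rightarrow> 'n set \<Rightarrow> ('n \<Rightarrow> nat) \<Rightarrow> real" where
  "sdd_coeff M X p n \<xi> y u i = integral\<^sup>L M (\<lambda>\<omega>. y (X \<omega>) * sdd_basis M X p n \<xi> u i (X \<omega>))"

definition sdd_approx ::
    "'w measure \<Rightarrow> ('w \<Rightarrow> real^'n) \<Rightarrow> ('n::finite \<Rightarrow> nat) \<Rightarrow> ('n \<Rightarrow> nat) \<Rightarrow> ('n \<Rightarrow> nat \<Rightarrow> real) \<Rightarrow>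
     (real^'n \<Rightarrow> real) \<Rightarrow> real^'n \<Rightarrow> real" where
  "sdd_approx M X p n \<xi> y x =
     integral\<^sup>L M (\<lambda>\<omega>. y (X \<omega>)) +
     (\<Sum>u | u \<noteq> {}. \<Sum>i\<in>sdd_indices n u. sdd_coeff M X p n \<xi> y u i * sdd_basis M X p n \<xi> u i x)"

definition weighted_L2_norm ::
    "(real^'n::finite) set \<Rightarrow> (real^'n \<Rightarrow> real) \<Rightarrow> (real^'n \<Rightarrow> real) \<Rightarrow> real" where
  "weighted_L2_norm A w h = sqrt (LINT x:A|lborel. \<bar>h x\<bar>\<^sup>2 * w x)"

end

theory Submission
  imports Defs "Jordan_Normal_Form.Determinant"
begin

text \<open>
  The approximation is an orthogonal projection. If the products
  \<open>\<Psi> j x = (\<Prod>k. \<psi> k (j k) (x $ k))\<close>, with \<open>j\<close> ranging over all multi-indices \<open>1 \<le> j k \<le> n k\<close>, are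
  orthonormal under the law of \<open>X\<close> and span the tensor-product spline space up to null sets, then the
  error of \<open>\<Sum>j. d j * \<Psi> j\<close> exceeds that of the Fourier sum \<open>\<Sum>j. E[y \<Psi> j] * \<Psi> j\<close> by
  \<open>\<Sum>j. (d j - E[y \<Psi> j])\<^sup>2\<close>, so the Fourier sum is best. The decomposition is this Fourier sum:
  the first univariate function is the constant \<open>1\<close>, so the multi-indices with \<open>j k \<noteq> 1\<close>
  exactly for \<open>k \<in> u\<close> contribute the terms that belong to \<open>u\<close>
  (\<open>sdd_approx_eq\<close>, \<open>sdd_approx_optimal\<close>).

  Orthonormality of the products follows from independence and the univariate case. There it reads
  \<open>Q\<^sup>-\<^sup>1 G (Q\<^sup>-\<^sup>1)\<^sup>T = 1\<close>, where \<open>G = Q Q\<^sup>T\<close>, and all that has to be shown is that the factorization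
  exists, that is, that the Gram matrix is positive definite. A spline whose mean square vanishes is
  \<open>0\<close> almost everywhere where the density is positive; the density is continuous and has full support,
  and splines are continuous from the right, so the spline is \<open>0\<close> on all of \<open>[a, b)\<close>
  (\<open>eq_0_on_support\<close>). Hence its coefficients vanish, because B-splines are linearly independent
  (\<open>bspline_independent\<close>): just to the right of the knot \<open>\<xi> i\<close>, the B-spline number \<open>i\<close> vanishes
  to a strictly lower order than all later ones. Replacing the first B-spline by \<open>1\<close> changes
  neither the span nor the independence, because on \<open>[a, b)\<close> the B-splines add up to \<open>1\<close>.

  At the right end points the B-splines vanish, so the constant \<open>1\<close> belongs to the spline space only
  on \<open>[a, b)\<close>. All identities between the two spaces therefore hold pointwise on the half-open box,
  whose complement in the closed box is a Lebesgue null set, and hence one for the law of \<open>X\<close>, whose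
  density is the product of the marginal densities (\<open>indep_components_joint_density\<close>). The joint density
  also turns the statement about mean squares into the one about weighted norms.
\<close>


section \<open>B-splines on open knot sequences\<close>

lemma bspline_eq_0_outside_support:
  assumes "mono_on {i..i + p + 1} \<xi>" "x < \<xi> i \<or> \<xi> (i + p + 1) \<le> x"
  shows "bspline \<xi> p i x = 0"
  using assms
proof (induction p arbitrary: i)
  case 0
  then show ?case by auto
next
  case (Suc p)
  have m: "\<xi> j \<le> \<xi> k" if "i \<le> j" "j \<le> k" "k \<le> i + Suc p + 1" for j k
    using Suc.prems(1) that by (auto simp: mono_on_def)
  have "mono_on {i..i + p + 1} \<xi>" "mono_on {Suc i..Suc i + p + 1} \<xi>"
    using Suc.prems(1) by (auto intro: mono_on_subset)
  moreover have "x < \<xi> i \<or> \<xi> (i + p + 1) \<le> x" "x < \<xi> (Suc i) \<or> \<xi> (Suc i + p + 1) \<le> x"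
    using Suc.prems(2) m[of i "Suc i"] m[of "i + p + 1" "i + p + 2"] by auto
  ultimately show ?case
    using Suc.IH[of i] Suc.IH[of "Suc i"] by simp
qed

text \<open>
  In passing from degree \<open>q\<close> to \<open>q + 1\<close>, each \<open>bspline \<xi> q i\<close> enters two neighbours with weights that
  add up to \<open>1\<close>. Only the two outermost ones have a single neighbour in the sum, and these vanish for
  \<open>x\<close> between \<open>\<xi> m\<close> and \<open>\<xi> (n + 1)\<close>. Letting the range of \<open>i\<close> grow with \<open>q\<close> makes the induction work;
  for an open knot sequence and \<open>m = p + 1\<close> it ends with \<open>{1..n}\<close>.
\<close>

lemma sum_bspline_window:
  assumes mono: "mono_on {m - q..n + q + 1} \<xi>" and "q < m" "m \<le> n"
    and x: "\<xi> m \<le> x" "x < \<xi> (n + 1)"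
  shows "(\<Sum>i = m - q..n. bspline \<xi> q i x) = 1"
  using mono \<open>q < m\<close>
proof (induction q)
  case 0
  define j where "j = (GREATEST j. j \<le> n \<and> \<xi> j \<le> x)"
  have ex: "m \<le> n \<and> \<xi> m \<le> x" using x \<open>m \<le> n\<close> by auto
  have j: "j \<le> n" "\<xi> j \<le> x" "m \<le> j"
    using GreatestI_nat[of "\<lambda>j. j \<le> n \<and> \<xi> j \<le> x" m n] Greatest_le_nat[of "\<lambda>j. j \<le> n \<and> \<xi> j \<le> x" m n] ex
    unfolding j_def by auto
  have above: "x < \<xi> (Suc j)"
    using Greatest_le_nat[of "\<lambda>j. j \<le> n \<and> \<xi> j \<le> x" "Suc j" n] j x(2)
    unfolding j_def[symmetric] by (cases "j = n") force+
  have mono': "\<xi> k \<le> \<xi> l" if "m \<le> k" "k \<le> l" "l \<le> n + 1" for k l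
    using 0(1) that by (auto simp: mono_on_def)
  have "bspline \<xi> 0 i x = (if i = j then 1 else 0)" if "i \<in> {m..n}" for i
    using j above mono'[of "Suc i" j] mono'[of "Suc j" i] that
    by (cases i j rule: linorder_cases) auto
  then show ?case
    using j by simp
next
  case (Suc q)
  define l where "l = m - Suc q"
  have ml: "m - q = Suc l" "l \<le> n" using Suc.prems \<open>m \<le> n\<close> by (auto simp: l_def)
  have mono': "\<xi> k \<le> \<xi> k'" if "l \<le> k" "k \<le> k'" "k' \<le> n + q + 2" for k k'
    using Suc.prems(1) that by (auto simp: mono_on_def l_def)
  \<comment> \<open>the two contributions of \<open>bspline \<xi> q i\<close>, to the B-splines number \<open>i\<close> and \<open>i - 1\<close> of the next degree\<close>
  define A where "A i = (x - \<xi> i) / (\<xi> (i + Suc q) - \<xi> i) * bspline \<xi> q i x" for i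
  define B where "B i = (\<xi> (i + Suc q) - x) / (\<xi> (i + Suc q) - \<xi> i) * bspline \<xi> q i x" for i
  have z: "bspline \<xi> q i x = 0" if "l \<le> i" "i \<le> n + 1" "x < \<xi> i \<or> \<xi> (i + q + 1) \<le> x" for i
    by (rule bspline_eq_0_outside_support) (use that mono' in \<open>auto simp: mono_on_def\<close>)
  have AB: "A i + B i = bspline \<xi> q i x" if "i \<in> {Suc l..n}" for i
  proof (cases "\<xi> (i + Suc q) = \<xi> i")
    case True
    then have "bspline \<xi> q i x = 0"
      by (intro z) (use that in \<open>auto simp: not_less\<close>)
    then show ?thesis by (simp add: A_def B_def)
  next
    case False
    then show ?thesis
      by (simp add: A_def B_def distrib_right[symmetric] add_divide_distrib[symmetric])
  qed
  have "A l = 0"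
    using z[of l] x(1) \<open>l \<le> n\<close> Suc.prems(2) by (simp add: A_def l_def)
  have "B (Suc n) = 0"
    using z[of "Suc n"] x \<open>l \<le> n\<close> by (simp add: B_def)
  have "(\<Sum>i = m - Suc q..n. bspline \<xi> (Suc q) i x) = (\<Sum>i = l..n. A i) + (\<Sum>i = l..n. B (Suc i))"
    by (simp add: A_def B_def l_def sum.distrib)
  also have "(\<Sum>i = l..n. A i) = (\<Sum>i = Suc l..n. A i)"
    using \<open>A l = 0\<close> \<open>l \<le> n\<close> by (subst sum.atLeast_Suc_atMost) auto
  also have "(\<Sum>i = l..n. B (Suc i)) = (\<Sum>i = Suc l..n. B i)"
    using \<open>B (Suc n) = 0\<close> \<open>l \<le> n\<close> by (subst sum.shift_bounds_cl_Suc_ivl[symmetric]) simp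
  also have "(\<Sum>i = Suc l..n. A i) + (\<Sum>i = Suc l..n. B i) = (\<Sum>i = m - q..n. bspline \<xi> q i x)"
    unfolding sum.distrib[symmetric] ml by (intro sum.cong refl AB)
  also have "\<dots> = 1"
    using Suc.prems by (intro Suc.IH) (auto elim!: mono_on_subset)
  finally show ?case .
qed

text \<open>
  The \<open>p + 1\<close> knots equal to \<open>a\<close> form an initial segment by monotonicity.
\<close>

lemma open_knots_left:
  assumes "open_knots a b p n \<xi>" "i \<in> {1..p + 1}"
  shows "\<xi> i = a"
proof (rule ccontr)
  assume ne: "\<xi> i \<noteq> a"
  let ?K = "{j \<in> {1..n + p + 1}. \<xi> j = a}"
  have mono: "\<xi> k \<le> \<xi> k'" if "1 \<le> k" "k \<le> k'" "k' \<le> n + p + 1" for k k'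
    using assms(1) that by (auto simp: open_knots_def mono_on_def)
  have a: "\<xi> 1 = a" and pn: "p < n" and card: "card ?K = p + 1"
    using assms(1) by (auto simp: open_knots_def knot_mult_def)
  have "?K \<subseteq> {1..<i}"
  proof
    fix j assume j: "j \<in> ?K"
    then show "j \<in> {1..<i}"
      using mono[of 1 i] mono[of i j] ne a assms(2) pn by (cases "j < i") auto
  qed
  then have "card ?K \<le> card {1..<i}" by (rule card_mono[rotated]) simp
  then show False using card assms(2) by auto
qed

lemma open_knots_right:
  assumes "open_knots a b p n \<xi>" "i \<in> {n + 1..n + p + 1}"
  shows "\<xi> i = b"
proof (rule ccontr)
  assume ne: "\<xi> i \<noteq> b"
  let ?K = "{j \<in> {1..n + p + 1}. \<xi> j = b}"
  have mono: "\<xi> k \<le> \<xi> k'" if "1 \<le> k" "k \<le> k'" "k' \<le> n + p + 1" for k k'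
    using assms(1) that by (auto simp: open_knots_def mono_on_def)
  have b: "\<xi> (n + p + 1) = b" and pn: "p < n" and card: "card ?K = p + 1"
    using assms(1) by (auto simp: open_knots_def knot_mult_def)
  have "?K \<subseteq> {i<..n + p + 1}"
  proof
    fix j assume j: "j \<in> ?K"
    then show "j \<in> {i<..n + p + 1}"
      using mono[of i "n + p + 1"] mono[of j i] ne b assms(2) pn by (cases "i < j") auto
  qed
  then have "card ?K \<le> card {i<..n + p + 1}" by (rule card_mono[rotated]) simp
  then show False using card assms(2) by auto
qed

lemma open_knots_mono:
  assumes "open_knots a b p n \<xi>" "1 \<le> i" "i \<le> j" "j \<le> n + p + 1"
  shows "\<xi> i \<le> \<xi> j"
  using assms by (auto simp: open_knots_def mono_on_def)

lemma open_knots_support_nonempty: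
  assumes "open_knots a b p n \<xi>" "i \<in> {1..n}"
  shows "\<xi> i < \<xi> (i + p + 1)"
proof (rule ccontr)
  assume empty: "\<not> \<xi> i < \<xi> (i + p + 1)"
  let ?K = "{j \<in> {1..n + p + 1}. \<xi> j = \<xi> i}"
  have "{i..i + p + 1} \<subseteq> ?K"
  proof
    fix j assume "j \<in> {i..i + p + 1}"
    then show "j \<in> ?K"
      using open_knots_mono[OF assms(1), of i j] open_knots_mono[OF assms(1), of j "i + p + 1"]
        assms(2) empty by auto
  qed
  then have "card {i..i + p + 1} \<le> card ?K" by (rule card_mono[rotated]) simp
  moreover have "card ?K \<le> p + 1"
    using assms by (auto simp: open_knots_def knot_mult_def)
  ultimately show False by simp
qed

lemma sum_bspline_eq_1:
  assumes "open_knots a b p n \<xi>" "a \<le> x" "x < b"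
  shows "(\<Sum>i = 1..n. bspline \<xi> p i x) = 1"
  using sum_bspline_window[of "p + 1" p n \<xi> x] open_knots_left[OF assms(1), of "p + 1"]
    open_knots_right[OF assms(1), of "n + 1"] assms
  by (simp add: open_knots_def)

lemma bspline_measurable [measurable]: "bspline \<xi> p i \<in> borel_measurable borel"
proof (induction p arbitrary: i)
  case 0
  have "bspline \<xi> 0 i = indicator {\<xi> i..<\<xi> (i + 1)}"
    by (auto simp: fun_eq_iff indicator_def)
  then show ?case by simp
next
  case (Suc p)
  note [measurable] = Suc.IH
  have "bspline \<xi> (Suc p) i = (\<lambda>x. (x - \<xi> i) / (\<xi> (i + Suc p) - \<xi> i) * bspline \<xi> p i x +
     (\<xi> (i + Suc p + 1) - x) / (\<xi> (i + Suc p + 1) - \<xi> (i + 1)) * bspline \<xi> p (i + 1) x)"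
    by (simp add: fun_eq_iff)
  also have "\<dots> \<in> borel_measurable borel" by measurable
  finally show ?case .
qed

lemma bspline_bounded: "\<exists>C. \<forall>x\<in>{a..b}. \<bar>bspline \<xi> p i x\<bar> \<le> C"
proof (induction p arbitrary: i)
  case 0
  show ?case by (rule exI[of _ 1]) auto
next
  case (Suc p)
  obtain C D where CD: "\<forall>x\<in>{a..b}. \<bar>bspline \<xi> p i x\<bar> \<le> C" "\<forall>x\<in>{a..b}. \<bar>bspline \<xi> p (i + 1) x\<bar> \<le> D"
    using Suc.IH by meson
  define K where "K = \<bar>a\<bar> + \<bar>b\<bar>"
  have "\<bar>bspline \<xi> (Suc p) i x\<bar> \<le> (K + \<bar>\<xi> i\<bar>) / \<bar>\<xi> (i + Suc p) - \<xi> i\<bar> * C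
     + (K + \<bar>\<xi> (i + Suc p + 1)\<bar>) / \<bar>\<xi> (i + Suc p + 1) - \<xi> (i + 1)\<bar> * D" if "x \<in> {a..b}" for x
    unfolding bspline.simps
    by (rule order_trans[OF abs_triangle_ineq], unfold abs_mult abs_divide)
       (intro add_mono mult_mono divide_right_mono; use that CD in \<open>auto simp: K_def\<close>)
  then show ?case by blast
qed

lemma bspline_right_continuous: "continuous (at_right x) (bspline \<xi> p i)"
proof (induction p arbitrary: i)
  case 0
  have "eventually (\<lambda>y. bspline \<xi> 0 i y = bspline \<xi> 0 i x) (at_right x)"
  proof -
    consider "x < \<xi> i" | "\<xi> i \<le> x" "x < \<xi> (i + 1)" | "\<xi> i \<le> x" "\<xi> (i + 1) \<le> x" by linarith
    then show ?thesis
    proof cases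
      case 1
      then show ?thesis
        using eventually_at_right_less[of x] eventually_at_right_field
        by (auto simp: eventually_at_right_field intro!: exI[of _ "\<xi> i"])
    next
      case 2
      then show ?thesis
        by (auto simp: eventually_at_right_field intro!: exI[of _ "\<xi> (i + 1)"])
    next
      case 3
      then show ?thesis
        by (auto simp: eventually_at_right_field intro!: exI[of _ "x + 1"])
    qed
  qed
  then show ?case
    by (simp only: continuous_within) (rule tendsto_eventually)
next
  case (Suc p)
  have *: "bspline \<xi> (Suc p) i = (\<lambda>y. (y - \<xi> i) * inverse (\<xi> (i + Suc p) - \<xi> i) * bspline \<xi> p i y +
     (\<xi> (i + Suc p + 1) - y) * inverse (\<xi> (i + Suc p + 1) - \<xi> (i + 1)) * bspline \<xi> p (i + 1) y)"
    by (auto simp: fun_eq_iff divide_inverse)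
  show ?case
    unfolding * by (intro continuous_intros Suc.IH)
qed

text \<open>
  Each factor in the recursion that vanishes at \<open>t\<close> raises the order of vanishing by one, and each knot
  that coincides with \<open>t\<close> replaces such a factor by one that is positive at \<open>t\<close>. The two summands of the
  recursion have the same order and nonnegative leading coefficients, so nothing cancels; the first one
  is missing when \<open>m = q + 1\<close>, the second one when \<open>m = 1\<close> (for B-splines of degree \<open>q\<close>).
\<close>

lemma bspline_leading_order:
  assumes "mono_on {i..i + q + 1} \<xi>" "1 \<le> m" "m \<le> q + 1"
    and "\<And>j. j < m \<Longrightarrow> \<xi> (i + j) = t" "t < \<xi> (i + m)"
  shows "\<exists>h. continuous_on UNIV h \<and> 0 < h t \<and>
    (\<forall>x\<in>{t..<\<xi> (i + m)}. bspline \<xi> q i x = (x - t) ^ (q + 1 - m) * h x)"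
  using assms
proof (induction q arbitrary: i m)
  case 0
  then show ?case by (intro exI[of _ "\<lambda>_. 1"]) (auto simp: le_Suc_eq)
next
  case (Suc q)
  have mono: "\<xi> j \<le> \<xi> k" if "i \<le> j" "j \<le> k" "k \<le> i + Suc q + 1" for j k
    using Suc.prems(1) that by (auto simp: mono_on_def)
  have t: "\<xi> i = t" using Suc.prems(2) Suc.prems(4)[of 0] by simp
  have A: "\<exists>h. continuous_on UNIV h \<and> 0 \<le> h t \<and> (m \<le> q + 1 \<longrightarrow> 0 < h t) \<and>
    (\<forall>x\<in>{t..<\<xi> (i + m)}. (x - \<xi> i) / (\<xi> (i + Suc q) - \<xi> i) * bspline \<xi> q i x = (x - t) ^ (Suc q + 1 - m) * h x)"
  proof (cases "m \<le> q + 1")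
    case True
    obtain h where h: "continuous_on UNIV h" "0 < h t"
      "\<forall>x\<in>{t..<\<xi> (i + m)}. bspline \<xi> q i x = (x - t) ^ (q + 1 - m) * h x"
      using Suc.IH[of i m] Suc.prems True mono_on_subset[OF Suc.prems(1), of "{i..i + q + 1}"] by auto
    have pos: "0 < \<xi> (i + Suc q) - t"
      using mono[of "i + m" "i + Suc q"] True Suc.prems(5) by auto
    have "Suc q + 1 - m = Suc (q + 1 - m)" using True by simp
    then show ?thesis
      using h pos by (intro exI[of _ "\<lambda>x. h x / (\<xi> (i + Suc q) - t)"]) (auto intro!: continuous_intros simp: t)
  next
    case False
    then have "\<xi> (i + Suc q) = t" using Suc.prems(4)[of "Suc q"] by simp
    then show ?thesis
      using False by (intro exI[of _ "\<lambda>_. 0"]) (auto simp: t)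
  qed
  have B: "\<exists>h. continuous_on UNIV h \<and> 0 \<le> h t \<and> (2 \<le> m \<longrightarrow> 0 < h t) \<and>
    (\<forall>x\<in>{t..<\<xi> (i + m)}. (\<xi> (i + Suc q + 1) - x) / (\<xi> (i + Suc q + 1) - \<xi> (i + 1)) * bspline \<xi> q (i + 1) x
      = (x - t) ^ (Suc q + 1 - m) * h x)"
  proof (cases "2 \<le> m")
    case True
    then obtain m' where m': "m = Suc m'" "1 \<le> m'" by (cases m) auto
    obtain h where h: "continuous_on UNIV h" "0 < h t"
      "\<forall>x\<in>{t..<\<xi> (i + m)}. bspline \<xi> q (i + 1) x = (x - t) ^ (q + 1 - m') * h x"
      using Suc.IH[of "i + 1" m'] Suc.prems(2,3,5) Suc.prems(4)[of "Suc _"] m'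
        mono_on_subset[OF Suc.prems(1), of "{i + 1..i + 1 + q + 1}"] by auto
    have t1: "\<xi> (i + 1) = t" using Suc.prems(4)[of 1] True by simp
    have pos: "0 < \<xi> (i + Suc q + 1) - t"
      using mono[of "i + m" "i + Suc q + 1"] Suc.prems(3,5) by auto
    have "Suc q + 1 - m = q + 1 - m'" using m' by simp
    then show ?thesis
      using h pos
      by (intro exI[of _ "\<lambda>x. (\<xi> (i + Suc q + 1) - x) * h x / (\<xi> (i + Suc q + 1) - t)"])
         (auto intro!: continuous_intros simp: t1[simplified])
  next
    case False
    then have "m = 1" using Suc.prems(2) by simp
    have "bspline \<xi> q (i + 1) x = 0" if "x \<in> {t..<\<xi> (i + m)}" for x
      by (rule bspline_eq_0_outside_support) (use that \<open>m = 1\<close> mono in \<open>auto simp: mono_on_def\<close>)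
    then show ?thesis
      by (intro exI[of _ "\<lambda>_. 0"]) (simp add: \<open>m = 1\<close>)
  qed
  from A B obtain h k where
    "continuous_on UNIV h" "0 \<le> h t" "m \<le> q + 1 \<longrightarrow> 0 < h t"
    "\<forall>x\<in>{t..<\<xi> (i + m)}. (x - \<xi> i) / (\<xi> (i + Suc q) - \<xi> i) * bspline \<xi> q i x = (x - t) ^ (Suc q + 1 - m) * h x"
    "continuous_on UNIV k" "0 \<le> k t" "2 \<le> m \<longrightarrow> 0 < k t"
    "\<forall>x\<in>{t..<\<xi> (i + m)}. (\<xi> (i + Suc q + 1) - x) / (\<xi> (i + Suc q + 1) - \<xi> (i + 1)) * bspline \<xi> q (i + 1) x
      = (x - t) ^ (Suc q + 1 - m) * k x"
    by blast
  then show ?case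
    by (intro exI[of _ "\<lambda>x. h x + k x"])
       (auto intro!: continuous_intros simp: distrib_left intro: add_pos_nonneg add_nonneg_pos)
qed

text \<open>
  If the coefficients before \<open>i\<close> vanish, divide the sum by \<open>(x - \<xi> i) ^ (p + 1 - m)\<close>, where \<open>m\<close> counts the
  knots from number \<open>i\<close> on that equal \<open>\<xi> i\<close>, and let \<open>x\<close> tend to \<open>\<xi> i\<close> from the right. The term with number
  \<open>i\<close> keeps a positive factor. A later B-spline that starts at the same knot has fewer copies of it, hence
  a higher order of vanishing, and one that starts at a later knot is \<open>0\<close> near \<open>\<xi> i\<close>. So only \<open>c i\<close>
  survives in the limit.
\<close>

lemma bspline_independent:
  assumes knots: "open_knots a b p n \<xi>"
    and zero: "\<And>x. a \<le> x \<Longrightarrow> x < b \<Longrightarrow> (\<Sum>i = 1..n. c i * bspline \<xi> p i x) = 0"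
  shows "i \<in> {1..n} \<Longrightarrow> c i = 0"
proof (induction i rule: less_induct)
  case (less i)
  define t where "t = \<xi> i"
  note mono = open_knots_mono[OF knots]
  have i: "1 \<le> i" "i \<le> n" using less.prems by auto
  \<comment> \<open>\<open>\<xi> i = \<dots> = \<xi> (i + m - 1) = t < \<xi> (i + m)\<close>; such an \<open>m \<le> p + 1\<close> exists because of the bound on the multiplicities\<close>
  define m where "m = (LEAST m. t < \<xi> (i + m))"
  have ex: "t < \<xi> (i + (p + 1))"
    using open_knots_support_nonempty[OF knots less.prems] by (simp add: t_def add.assoc)
  have tm: "t < \<xi> (i + m)" and mp: "m \<le> p + 1"
    unfolding m_def using ex by (rule LeastI, rule Least_le)
  have "m \<noteq> 0" using tm by (auto simp: t_def intro: ccontr)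
  have eq: "\<xi> (i + j) = t" if "j < m" for j
  proof -
    have "\<not> t < \<xi> (i + j)" using not_less_Least that by (auto simp: m_def)
    then show ?thesis using mono[of i "i + j"] that mp i by (auto simp: t_def)
  qed
  have "a \<le> t" using mono[of 1 i] knots i by (auto simp: open_knots_def t_def)
  have "\<xi> (i + m) \<le> b" using mono[of "i + m" "n + p + 1"] knots i mp by (auto simp: open_knots_def)
  let ?e = "p + 1 - m"
  let ?F = "at_right t"
  have ev: "eventually (\<lambda>x. x \<in> {t<..<\<xi> (i + m)}) ?F"
    by (rule eventually_at_rightI[OF _ tm])
  have order: "\<exists>h. continuous_on UNIV h \<and> 0 < h t \<and>
      (\<forall>x\<in>{t..<\<xi> (i + m)}. bspline \<xi> p (i + d) x = (x - t) ^ (p + 1 - (m - d)) * h x)"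
    if "d < m" "i + d \<le> n" for d
  proof -
    have "mono_on {i + d..i + d + p + 1} \<xi>"
      using mono that i by (auto simp: mono_on_def)
    then show ?thesis
      using bspline_leading_order[of "i + d" p \<xi> "m - d" t] that mp tm eq[of "d + _"]
      by (auto simp: add.assoc)
  qed
  obtain h where h: "continuous_on UNIV h" "0 < h t"
    "\<And>x. x \<in> {t..<\<xi> (i + m)} \<Longrightarrow> bspline \<xi> p i x = (x - t) ^ ?e * h x"
    using order[of 0] \<open>m \<noteq> 0\<close> i by auto
  have main: "((\<lambda>x. bspline \<xi> p i x / (x - t) ^ ?e) \<longlongrightarrow> h t) ?F"
  proof (rule Lim_transform_eventually)
    show "(h \<longlongrightarrow> h t) ?F"
      using h(1) by (auto simp: continuous_on_def intro: tendsto_within_subset)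
    show "eventually (\<lambda>x. h x = bspline \<xi> p i x / (x - t) ^ ?e) ?F"
      using ev by eventually_elim (simp add: h(3))
  qed
  have later: "((\<lambda>x. bspline \<xi> p j x / (x - t) ^ ?e) \<longlongrightarrow> 0) ?F" if "i < j" "j \<le> n" for j
  proof (cases "j < i + m")
    case True
    define d where "d = j - i"
    have d: "j = i + d" "0 < d" "d < m" using that True by (auto simp: d_def)
    obtain k where k: "continuous_on UNIV k"
      "\<And>x. x \<in> {t..<\<xi> (i + m)} \<Longrightarrow> bspline \<xi> p j x = (x - t) ^ (p + 1 - (m - d)) * k x"
      using order[of d] d \<open>j \<le> n\<close> by (auto simp: Ball_def)
    show ?thesis
    proof (rule Lim_transform_eventually)
      have "(k \<longlongrightarrow> k t) ?F"
        using k(1) by (auto simp: continuous_on_def intro: tendsto_within_subset)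
      then have "((\<lambda>x. (x - t) ^ d * k x) \<longlongrightarrow> (t - t) ^ d * k t) ?F"
        by (intro tendsto_intros)
      then show "((\<lambda>x. (x - t) ^ d * k x) \<longlongrightarrow> 0) ?F" using d by (simp add: zero_power)
      have e: "p + 1 - (m - d) = ?e + d" using d mp by simp
      show "eventually (\<lambda>x. (x - t) ^ d * k x = bspline \<xi> p j x / (x - t) ^ ?e) ?F"
        using ev
      proof eventually_elim
        case (elim x)
        then have "bspline \<xi> p j x = (x - t) ^ (?e + d) * k x"
          using k(2)[of x] unfolding e by auto
        then show ?case using elim by (simp add: power_add)
      qed
    qed
  next
    case False
    have "\<xi> (i + m) \<le> \<xi> j" using mono[of "i + m" j] False i \<open>j \<le> n\<close> by simp
    moreover have "mono_on {j..j + p + 1} \<xi>"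
      using mono \<open>i < j\<close> \<open>j \<le> n\<close> by (auto simp: mono_on_def)
    ultimately have "bspline \<xi> p j x = 0" if "x < \<xi> (i + m)" for x
      using that by (intro bspline_eq_0_outside_support) auto
    then show ?thesis
      by (intro tendsto_eventually eventually_mono[OF ev]) simp
  qed
  have "((\<lambda>x. \<Sum>j = i..n. c j * (bspline \<xi> p j x / (x - t) ^ ?e)) \<longlongrightarrow>
      (\<Sum>j = i..n. c j * (if j = i then h t else 0))) ?F"
    using main later by (intro tendsto_intros) auto
  also have "(\<Sum>j = i..n. c j * (if j = i then h t else 0)) = c i * h t"
    using i by (simp add: if_distrib[of "(*) _"] cong: if_cong)
  finally have lim: "((\<lambda>x. \<Sum>j = i..n. c j * (bspline \<xi> p j x / (x - t) ^ ?e)) \<longlongrightarrow> c i * h t) ?F" .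
  have "eventually (\<lambda>x. (\<Sum>j = i..n. c j * (bspline \<xi> p j x / (x - t) ^ ?e)) = 0) ?F"
    using ev
  proof eventually_elim
    case (elim x)
    have "(\<Sum>j = 1..n. c j * bspline \<xi> p j x) = (\<Sum>j = i..n. c j * bspline \<xi> p j x)"
      by (rule sum.mono_neutral_right) (use i less.IH in auto)
    moreover have "(\<Sum>j = 1..n. c j * bspline \<xi> p j x) = 0"
      using elim \<open>a \<le> t\<close> \<open>\<xi> (i + m) \<le> b\<close> by (intro zero) auto
    ultimately show ?case by (simp add: sum_divide_distrib[symmetric])
  qed
  then have "((\<lambda>x. \<Sum>j = i..n. c j * (bspline \<xi> p j x / (x - t) ^ ?e)) \<longlongrightarrow> 0) ?F"
    by (rule tendsto_eventually)
  then have "c i * h t = 0"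
    using lim by (rule tendsto_unique[OF trivial_limit_at_right_real, rotated])
  then show ?case using h(2) by simp
qed

section \<open>Cholesky factorization\<close>

text \<open>
  Elimination of the first variable: the Schur complement \<open>G'\<close> of the entry \<open>G 0 0\<close> is again positive definite,
  because its form at \<open>c\<close> is the minimum of the form of \<open>G\<close> over all vectors that continue \<open>c\<close> by an entry
  in position \<open>0\<close>.
\<close>

lemma cholesky_exists:
  fixes G :: "nat \<Rightarrow> nat \<Rightarrow> real"
  assumes "\<And>i j. i < n \<Longrightarrow> j < n \<Longrightarrow> G i j = G j i"
    and "\<And>c. \<exists>i<n. c i \<noteq> 0 \<Longrightarrow> 0 < (\<Sum>i<n. \<Sum>j<n. c i * c j * G i j)"
  shows "\<exists>q. (\<forall>i j. i < j \<longrightarrow> q i j = 0) \<and> (\<forall>i<n. 0 < q i i) \<and>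
    (\<forall>i<n. \<forall>j<n. G i j = (\<Sum>k<n. q i k * q j k))"
  using assms
proof (induction n arbitrary: G)
  case 0
  show ?case by (intro exI[of _ "\<lambda>_ _. 0"]) simp
next
  case (Suc n)
  have "(\<Sum>i<Suc n. \<Sum>j<Suc n. (if i = 0 then 1 else 0) * (if j = 0 then 1 else 0) * G i j) = G 0 0"
    by (simp add: sum.lessThan_Suc_shift del: sum.lessThan_Suc)
  with Suc.prems(2)[of "\<lambda>i. if i = 0 then 1 else 0"] have pos: "0 < G 0 0" by auto
  have sym: "G 0 (Suc i) = G (Suc i) 0" if "i < n" for i
    using Suc.prems(1)[of 0 "Suc i"] that by simp
  define v where "v i = G (Suc i) 0 / sqrt (G 0 0)" for i
  define G' where "G' i j = G (Suc i) (Suc j) - v i * v j" for i j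
  have vv: "v i * v j = G (Suc i) 0 * G (Suc j) 0 / G 0 0" for i j
    using pos by (simp add: v_def)
  have "\<exists>q. (\<forall>i j. i < j \<longrightarrow> q i j = 0) \<and> (\<forall>i<n. 0 < q i i) \<and>
    (\<forall>i<n. \<forall>j<n. G' i j = (\<Sum>k<n. q i k * q j k))"
  proof (rule Suc.IH)
    show "G' i j = G' j i" if "i < n" "j < n" for i j
      using that Suc.prems(1)[of "Suc i" "Suc j"] by (simp add: G'_def mult.commute)
  next
    fix c :: "nat \<Rightarrow> real" assume c: "\<exists>i<n. c i \<noteq> 0"
    define S where "S = (\<Sum>i<n. c i * G (Suc i) 0)"
    \<comment> \<open>the first entry minimizes the quadratic form of \<open>G\<close> for given later entries\<close>
    define C where "C i = (case i of 0 \<Rightarrow> - S / G 0 0 | Suc i \<Rightarrow> c i)" for i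
    have C [simp]: "C 0 = - S / G 0 0" "C (Suc i) = c i" for i by (simp_all add: C_def)
    have SS: "(\<Sum>i<n. \<Sum>j<n. c i * c j * (v i * v j)) = S * S / G 0 0"
      unfolding S_def sum_product vv sum_divide_distrib by (intro sum.cong refl) simp
    have S1: "(\<Sum>j<n. C 0 * c j * G 0 (Suc j)) = C 0 * S"
      unfolding S_def sum_distrib_left by (intro sum.cong refl) (simp add: sym)
    have S2: "(\<Sum>i<n. c i * C 0 * G (Suc i) 0) = C 0 * S"
      unfolding S_def sum_distrib_left by (intro sum.cong refl) simp
    have "\<exists>i<Suc n. C i \<noteq> 0" using c by (metis C(2) Suc_less_eq)
    then have "0 < (\<Sum>i<Suc n. \<Sum>j<Suc n. C i * C j * G i j)" by (rule Suc.prems(2))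
    also have "\<dots> = C 0 * C 0 * G 0 0 + (\<Sum>j<n. C 0 * c j * G 0 (Suc j)) + (\<Sum>i<n. c i * C 0 * G (Suc i) 0)
        + (\<Sum>i<n. \<Sum>j<n. c i * c j * G (Suc i) (Suc j))"
      by (simp add: sum.lessThan_Suc_shift sum.distrib del: sum.lessThan_Suc C(1))
    also have "\<dots> = (\<Sum>i<n. \<Sum>j<n. c i * c j * G (Suc i) (Suc j)) - S * S / G 0 0"
      unfolding S1 S2 using pos by (simp add: field_simps)
    also have "\<dots> = (\<Sum>i<n. \<Sum>j<n. c i * c j * G' i j)"
      unfolding G'_def right_diff_distrib sum_subtractf SS ..
    finally show "0 < (\<Sum>i<n. \<Sum>j<n. c i * c j * G' i j)" .
  qed
  then obtain q' where q': "\<And>i j. i < j \<Longrightarrow> q' i j = 0" "\<And>i. i < n \<Longrightarrow> 0 < q' i i"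
    "\<And>i j. i < n \<Longrightarrow> j < n \<Longrightarrow> G' i j = (\<Sum>k<n. q' i k * q' j k)"
    by blast
  define q where "q i j = (case i of 0 \<Rightarrow> (if j = 0 then sqrt (G 0 0) else 0)
     | Suc i \<Rightarrow> (case j of 0 \<Rightarrow> v i | Suc j \<Rightarrow> q' i j))" for i j
  have "G i j = (\<Sum>k<Suc n. q i k * q j k)" if "i < Suc n" "j < Suc n" for i j
    using that pos sym q'(3)
    by (cases i; cases j)
       (auto simp: q_def sum.lessThan_Suc_shift v_def[of "_ - 1"] G'_def v_def algebra_simps simp del: sum.lessThan_Suc)
  moreover have "q i j = 0" if "i < j" for i j
    using that q'(1) by (auto simp: q_def split: nat.split)
  moreover have "0 < q i i" if "i < Suc n" for i
    using that q'(2) pos by (auto simp: q_def split: nat.split)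
  ultimately show ?case by blast
qed

text \<open>
  Existence makes the properties by which the factor is chosen available.
\<close>

lemma cholesky_factor_mat:
  assumes "\<And>i j. i < n \<Longrightarrow> j < n \<Longrightarrow> G i j = G j i"
    and "\<And>c. \<exists>i<n. c i \<noteq> 0 \<Longrightarrow> 0 < (\<Sum>i<n. \<Sum>j<n. c i * c j * G i j)"
  defines "Q \<equiv> cholesky_factor (Matrix.mat n n (\<lambda>(i, j). G i j))"
  shows "Q \<in> carrier_mat n n" "\<And>i j. i < j \<Longrightarrow> j < n \<Longrightarrow> Q $$ (i, j) = 0"
    "\<And>i. i < n \<Longrightarrow> 0 < Q $$ (i, i)" "Q * transpose_mat Q = Matrix.mat n n (\<lambda>(i, j). G i j)"
proof -
  let ?P = "\<lambda>Q. Q \<in> carrier_mat n n \<and> upper_triangular (transpose_mat Q) \<and>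
    (\<forall>i < dim_row Q. Q $$ (i, i) > 0) \<and> Matrix.mat n n (\<lambda>(i, j). G i j) = Q * transpose_mat Q"
  obtain q where q: "\<forall>i j. i < j \<longrightarrow> q i j = 0" "\<forall>i<n. 0 < q i i"
    "\<forall>i<n. \<forall>j<n. G i j = (\<Sum>k<n. q i k * q j k)"
    using cholesky_exists[of n G] assms(1,2) by blast
  have P: "?P (Matrix.mat n n (\<lambda>(i, j). q i j))"
    using q by (auto simp: upper_triangular_def scalar_prod_def atLeast0LessThan intro!: eq_matI)
  have "?P Q"
    unfolding Q_def cholesky_factor_def dim_row_mat by (rule someI[of ?P, OF P])
  then show "Q \<in> carrier_mat n n" "\<And>i j. i < j \<Longrightarrow> j < n \<Longrightarrow> Q $$ (i, j) = 0"
    "\<And>i. i < n \<Longrightarrow> 0 < Q $$ (i, i)" "Q * transpose_mat Q = Matrix.mat n n (\<lambda>(i, j). G i j)"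
    by (auto simp: upper_triangular_def)
qed

lemma lower_triangular_mat_inverse:
  fixes Q :: "real Matrix.mat"
  assumes Q: "Q \<in> carrier_mat n n" and "\<And>i j. i < j \<Longrightarrow> j < n \<Longrightarrow> Q $$ (i, j) = 0"
    and pos: "\<And>i. i < n \<Longrightarrow> 0 < Q $$ (i, i)"
  defines "Q_inv \<equiv> the (mat_inverse Q)"
  shows "Q_inv \<in> carrier_mat n n" "Q_inv * Q = 1\<^sub>m n" "Q * Q_inv = 1\<^sub>m n"
proof -
  have "det Q = prod_list (diag_mat Q)"
    by (rule det_lower_triangular[OF _ Q]) (use assms in auto)
  moreover have "0 \<notin> set (diag_mat Q)"
    using Q pos by (force simp: diag_mat_def)
  ultimately have "Determinant.det Q \<noteq> 0"
    by (simp add: prod_list_zero_iff)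
  then have "Q \<in> Units (ring_mat TYPE(real) n ())"
    by (rule det_non_zero_imp_unit[OF Q])
  then have "mat_inverse Q \<noteq> None"
    using mat_inverse(1)[OF Q, of "()"] by blast
  then have "mat_inverse Q = Some Q_inv"
    by (auto simp: Q_inv_def)
  from mat_inverse(2)[OF Q this] show "Q_inv \<in> carrier_mat n n" "Q_inv * Q = 1\<^sub>m n" "Q * Q_inv = 1\<^sub>m n"
    by auto
qed

section \<open>Orthonormal univariate splines\<close>

text \<open>
  To expand all elements of a span on a set \<open>A\<close> in the functions \<open>e\<close>, it suffices to expand the generators.
\<close>

lemma subspace_sums_on:
  "fun_space.subspace {g. \<exists>d. \<forall>x\<in>A. g x = (\<Sum>i\<in>I. d i * e i x)}"
  unfolding fun_space.subspace_def mem_Collect_eq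
proof (intro conjI ballI allI impI)
  show "\<exists>d. \<forall>x\<in>A. (0 :: _ \<Rightarrow> real) x = (\<Sum>i\<in>I. d i * e i x)"
    by (intro exI[of _ "\<lambda>_. 0"]) simp
next
  fix g h assume "g \<in> {g. \<exists>d. \<forall>x\<in>A. g x = (\<Sum>i\<in>I. d i * e i x)}" "h \<in> {g. \<exists>d. \<forall>x\<in>A. g x = (\<Sum>i\<in>I. d i * e i x)}"
  then obtain d d' where "\<forall>x\<in>A. g x = (\<Sum>i\<in>I. d i * e i x)" "\<forall>x\<in>A. h x = (\<Sum>i\<in>I. d' i * e i x)"
    by blast
  then show "\<exists>d. \<forall>x\<in>A. (g + h) x = (\<Sum>i\<in>I. d i * e i x)"
    by (intro exI[of _ "\<lambda>i. d i + d' i"]) (simp add: sum.distrib distrib_right)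
next
  fix c g assume "g \<in> {g. \<exists>d. \<forall>x\<in>A. g x = (\<Sum>i\<in>I. d i * e i x)}"
  then obtain d where "\<forall>x\<in>A. g x = (\<Sum>i\<in>I. d i * e i x)" by blast
  then show "\<exists>d. \<forall>x\<in>A. c * g x = (\<Sum>i\<in>I. d i * e i x)"
    by (intro exI[of _ "\<lambda>i. c * d i"]) (simp add: sum_distrib_left mult.assoc)
qed

lemma sum_in_span:
  assumes "\<And>i. i \<in> I \<Longrightarrow> e i \<in> fun_space.span B"
  shows "(\<lambda>x. \<Sum>i\<in>I. d i * e i x) \<in> fun_space.span B"
proof -
  have "(\<lambda>x. \<Sum>i\<in>I. d i * e i x) = (\<Sum>i\<in>I. (\<lambda>x. d i * e i x))"
    by (induction I rule: infinite_finite_induct) (auto simp: fun_eq_iff)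
  then show ?thesis
    using assms by (auto intro!: fun_space.span_sum fun_space.span_scale)
qed

lemma bounded_mult:
  fixes s t :: "'c \<Rightarrow> real"
  assumes "\<exists>C. \<forall>x\<in>A. \<bar>s x\<bar> \<le> C" "\<exists>C. \<forall>x\<in>A. \<bar>t x\<bar> \<le> C"
  shows "\<exists>C. \<forall>x\<in>A. \<bar>s x * t x\<bar> \<le> C"
proof -
  obtain C D where "\<forall>x\<in>A. \<bar>s x\<bar> \<le> C" "\<forall>x\<in>A. \<bar>t x\<bar> \<le> D" using assms by blast
  then have "\<forall>x\<in>A. \<bar>s x * t x\<bar> \<le> C * D"
    by (auto simp: abs_mult intro!: mult_mono intro: order_trans[OF abs_ge_zero])
  then show ?thesis by blast
qed

text \<open>
  One coordinate of the random vector in isolation, so that the orthonormalization is done once for all of them.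
\<close>

locale spline_variable = prob_space M for M :: "'w measure" +
  fixes Z :: "'w \<Rightarrow> real" and f :: "real \<Rightarrow> real" and a b :: real
    and p n :: nat and \<xi> :: "nat \<Rightarrow> real"
  assumes ab: "a < b"
    and Z_range: "\<And>\<omega>. \<omega> \<in> space M \<Longrightarrow> Z \<omega> \<in> {a..b}"
    and Z_density: "distributed M lborel Z (\<lambda>t. ennreal (f t))"
    and f_nonneg: "\<And>t. 0 \<le> f t"
    and f_cont: "continuous_on {a..b} f"
    and f_support: "closure {t. f t \<noteq> 0} = {a..b}"
    and knots: "open_knots a b p n \<xi>"
begin

lemma Z_measurable [measurable]: "Z \<in> borel_measurable M"
  using distributed_measurable[OF Z_density] by simp

lemma n_pos: "0 < n"
  using knots by (simp add: open_knots_def)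

lemma integrable_bounded:
  fixes s :: "real \<Rightarrow> real"
  assumes [measurable]: "s \<in> borel_measurable borel" and "\<exists>C. \<forall>x\<in>{a..b}. \<bar>s x\<bar> \<le> C"
  shows "integrable M (\<lambda>\<omega>. s (Z \<omega>))"
proof -
  obtain C where "\<forall>x\<in>{a..b}. \<bar>s x\<bar> \<le> C" using assms(2) by blast
  then show ?thesis
    by (intro integrable_const_bound[of _ C]) (use Z_range in \<open>auto intro!: AE_I2\<close>)
qed

text \<open>
  Otherwise \<open>s\<close> is nonzero on a whole interval to the right of \<open>x\<close>. Since the support of the density is
  \<open>{a..b}\<close>, the density is nonzero at a point of this interval, and by continuity on a subinterval, which has
  positive probability.
\<close>

lemma eq_0_on_support:
  fixes s :: "real \<Rightarrow> real"
  assumes [measurable]: "s \<in> borel_measurable borel" and cont: "\<And>x. continuous (at_right x) s"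
    and AE: "AE \<omega> in M. s (Z \<omega>) = 0" and x: "a \<le> x" "x < b"
  shows "s x = 0"
proof (rule ccontr)
  assume "s x \<noteq> 0"
  have AE': "AE t in lborel. 0 < ennreal (f t) \<longrightarrow> s t = 0"
  proof -
    have "Measurable.pred lborel (\<lambda>t. s t = 0)" by measurable
    then show ?thesis using AE distributed_AE2[OF Z_density, of "\<lambda>t. s t = 0"] by blast
  qed
  have "eventually (\<lambda>t. s t \<noteq> 0) (at_right x)"
    using cont[of x] \<open>s x \<noteq> 0\<close> unfolding continuous_within by (rule tendsto_imp_eventually_ne)
  then obtain c where c: "x < c" "\<And>t. x < t \<Longrightarrow> t < c \<Longrightarrow> s t \<noteq> 0"
    by (auto simp: eventually_at_right_field)
  define d where "d = min b c"
  have d: "x < d" "d \<le> b" "d \<le> c" using c x by (auto simp: d_def)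
  obtain z where z: "z \<in> {x<..<d}" "f z \<noteq> 0"
  proof -
    have "(x + d) / 2 \<in> closure {t. f t \<noteq> 0}" using f_support x d by auto
    moreover have "(x + d) / 2 \<in> {x<..<d}" "open {x<..<d}" using d by auto
    ultimately have "{x<..<d} \<inter> {t. f t \<noteq> 0} \<noteq> {}"
      by (metis disjoint_iff open_Int_closure_eq_empty)
    then show thesis using that by blast
  qed
  have "continuous_on {x<..<d} f"
    by (rule continuous_on_subset[OF f_cont]) (use x d in auto)
  then have "open ({x<..<d} \<inter> f -` (- {0}))"
    by (rule continuous_open_preimage) auto
  moreover have "z \<in> {x<..<d} \<inter> f -` (- {0})" using z by auto
  ultimately obtain e where "0 < e" "cball z e \<subseteq> {x<..<d} \<inter> f -` (- {0})"
    using open_contains_cball by blast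
  then obtain l u where lu: "l < u" "{l..u} \<subseteq> {x<..<d} \<inter> f -` (- {0})"
    using that[of "z - e" "z + e"] by (auto simp: cball_eq_atLeastAtMost)
  have "AE t in lborel. t \<notin> {l..u}"
    using AE'
  proof eventually_elim
    case (elim t)
    show ?case
    proof
      assume "t \<in> {l..u}"
      then have "t \<in> {x<..<d}" "f t \<noteq> 0" using lu by auto
      then show False using elim c(2)[of t] d f_nonneg[of t] by (auto simp: ennreal_less_zero_iff less_le)
    qed
  qed
  then have "emeasure lborel {l..u} = 0"
    by (subst (asm) AE_iff_measurable[of "{l..u}"]) auto
  then show False using lu by simp
qed

text \<open>
  The entries of the vector whose Gram matrix is factorized, numbered from \<open>0\<close> as in that vector: the
  B-splines number \<open>i + 1\<close>, with the first one replaced by the constant \<open>1\<close>.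
\<close>

definition spline_entry :: "nat \<Rightarrow> real \<Rightarrow> real" where
  "spline_entry i x = (if i = 0 then 1 else bspline \<xi> p (i + 1) x)"

lemma spline_entry_measurable [measurable]: "spline_entry i \<in> borel_measurable borel"
  unfolding spline_entry_def by (cases "i = 0") simp_all

lemma spline_entry_bounded: "\<exists>C. \<forall>x\<in>{a..b}. \<bar>spline_entry i x\<bar> \<le> C"
  using bspline_bounded[of a b \<xi> p "i + 1"] by (cases "i = 0") (auto simp: spline_entry_def)

lemma spline_entry_right_continuous: "continuous (at_right x) (spline_entry i)"
  using bspline_right_continuous[of x \<xi> p "i + 1"] by (cases "i = 0") (auto simp: spline_entry_def[abs_def])

lemma sum_spline_entry_measurable [measurable]: "(\<lambda>x. \<Sum>i<n. c i * spline_entry i x) \<in> borel_measurable borel"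
  by simp

lemma bounded_sum_spline_entry: "\<exists>C. \<forall>x\<in>{a..b}. \<bar>\<Sum>i<n. c i * spline_entry i x\<bar> \<le> C"
proof -
  obtain C where C: "\<And>i x. x \<in> {a..b} \<Longrightarrow> \<bar>spline_entry i x\<bar> \<le> C i"
    using spline_entry_bounded by metis
  have "\<bar>\<Sum>i<n. c i * spline_entry i x\<bar> \<le> (\<Sum>i<n. \<bar>c i\<bar> * C i)" if "x \<in> {a..b}" for x
    using C[OF that] by (intro order_trans[OF sum_abs] sum_mono) (simp add: abs_mult mult_left_mono)
  then show ?thesis by blast
qed

lemma bspline_1_eq:
  assumes "x \<in> {a..<b}"
  shows "bspline \<xi> p 1 x = spline_entry 0 x - (\<Sum>i\<in>{1..<n}. spline_entry i x)"
proof -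
  have "1 = (\<Sum>i<n. bspline \<xi> p (Suc i) x)"
    using sum_bspline_eq_1[OF knots, of x] assms by (simp add: sum.atLeast1_atMost_eq)
  also have "\<dots> = bspline \<xi> p 1 x + (\<Sum>i\<in>{1..<n}. bspline \<xi> p (Suc i) x)"
    using n_pos by (simp add: sum.atLeast_Suc_lessThan lessThan_atLeast0)
  also have "(\<Sum>i\<in>{1..<n}. bspline \<xi> p (Suc i) x) = (\<Sum>i\<in>{1..<n}. spline_entry i x)"
    by (intro sum.cong) (auto simp: spline_entry_def)
  finally show ?thesis by (simp add: spline_entry_def[of 0])
qed

text \<open>
  Writing \<open>1\<close> as the sum of all B-splines turns the coefficients \<open>c 0, c 1, \<dots>\<close> into the B-spline coefficients
  \<open>c 0, c 0 + c 1, c 0 + c 2, \<dots>\<close>, which determine the former.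
\<close>

lemma spline_entry_independent:
  assumes zero: "\<And>x. x \<in> {a..<b} \<Longrightarrow> (\<Sum>i<n. c i * spline_entry i x) = 0" and "i < n"
  shows "c i = 0"
proof -
  \<comment> \<open>coefficients with respect to the B-splines themselves, numbered from \<open>1\<close>\<close>
  define c' where "c' j = (if j = 1 then c 0 else c 0 + c (j - 1))" for j
  have "(\<Sum>j = 1..n. c' j * bspline \<xi> p j x) = 0" if "a \<le> x" "x < b" for x
  proof -
    have "(\<Sum>j = 1..n. c' j * bspline \<xi> p j x)
      = c 0 * (\<Sum>j = 1..n. bspline \<xi> p j x) + (\<Sum>j = 1..n. (if j = 1 then 0 else c (j - 1)) * bspline \<xi> p j x)"
      unfolding sum_distrib_left sum.distrib[symmetric]
      by (intro sum.cong refl) (simp add: c'_def distrib_right)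
    also have "(\<Sum>j = 1..n. bspline \<xi> p j x) = 1"
      using sum_bspline_eq_1[OF knots that] .
    also have "(\<Sum>j = 1..n. (if j = 1 then 0 else c (j - 1)) * bspline \<xi> p j x)
      = (\<Sum>i<n. (if i = 0 then 0 else c i * spline_entry i x))"
      by (simp add: sum.atLeast1_atMost_eq) (intro sum.cong; simp add: spline_entry_def)
    also have "c 0 * 1 + (\<Sum>i<n. (if i = 0 then 0 else c i * spline_entry i x)) = (\<Sum>i<n. c i * spline_entry i x)"
      using n_pos by (cases n) (simp_all add: sum.lessThan_Suc_shift spline_entry_def[of 0] del: sum.lessThan_Suc)
    finally show ?thesis using zero[of x] that by simp
  qed
  then have "c' j = 0" if "j \<in> {1..n}" for j
    using bspline_independent[OF knots] that by blast
  from this[of 1] this[of "Suc i"] show ?thesis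
    using \<open>i < n\<close> n_pos by (cases "i = 0") (auto simp: c'_def)
qed

definition gram :: "nat \<Rightarrow> nat \<Rightarrow> real" where
  "gram i j = expectation (\<lambda>\<omega>. spline_entry i (Z \<omega>) * spline_entry j (Z \<omega>))"

lemma integrable_spline_entry_mult: "integrable M (\<lambda>\<omega>. spline_entry i (Z \<omega>) * spline_entry j (Z \<omega>))"
  using integrable_bounded[of "\<lambda>x. spline_entry i x * spline_entry j x"] bounded_mult[OF spline_entry_bounded spline_entry_bounded] by simp

lemma expectation_spline_entry_bilinear:
  "expectation (\<lambda>\<omega>. (\<Sum>i<n. c i * spline_entry i (Z \<omega>)) * (\<Sum>j<n. d j * spline_entry j (Z \<omega>)))
    = (\<Sum>i<n. \<Sum>j<n. c i * d j * gram i j)"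
proof -
  have "(\<lambda>\<omega>. (\<Sum>i<n. c i * spline_entry i (Z \<omega>)) * (\<Sum>j<n. d j * spline_entry j (Z \<omega>)))
    = (\<lambda>\<omega>. \<Sum>i<n. \<Sum>j<n. c i * d j * (spline_entry i (Z \<omega>) * spline_entry j (Z \<omega>)))"
    unfolding sum_product by (intro ext sum.cong refl) simp
  then show ?thesis
    by (simp add: gram_def integrable_spline_entry_mult)
qed

lemma gram_commute: "gram i j = gram j i"
  by (simp add: gram_def mult.commute)

lemma gram_pos_def:
  assumes "\<exists>i<n. c i \<noteq> 0"
  shows "0 < (\<Sum>i<n. \<Sum>j<n. c i * c j * gram i j)"
proof -
  let ?s = "\<lambda>x. \<Sum>i<n. c i * spline_entry i x"
  have "0 \<le> expectation (\<lambda>\<omega>. ?s (Z \<omega>) * ?s (Z \<omega>))" by (rule integral_nonneg_AE) simp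
  moreover have "expectation (\<lambda>\<omega>. ?s (Z \<omega>) * ?s (Z \<omega>)) \<noteq> 0"
  proof
    assume "expectation (\<lambda>\<omega>. ?s (Z \<omega>) * ?s (Z \<omega>)) = 0"
    moreover have "integrable M (\<lambda>\<omega>. ?s (Z \<omega>) * ?s (Z \<omega>))"
    proof (rule integrable_bounded[of "\<lambda>x. ?s x * ?s x"])
      show "\<exists>C. \<forall>x\<in>{a..b}. \<bar>?s x * ?s x\<bar> \<le> C"
        by (intro bounded_mult bounded_sum_spline_entry)
    qed simp
    ultimately have "AE \<omega> in M. ?s (Z \<omega>) * ?s (Z \<omega>) = 0"
      by (subst (asm) integral_nonneg_eq_0_iff_AE) auto
    then have AE: "AE \<omega> in M. ?s (Z \<omega>) = 0" by simp
    have "?s x = 0" if "x \<in> {a..<b}" for x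
      using that by (intro eq_0_on_support[of ?s, OF sum_spline_entry_measurable _ AE])
        (auto intro!: continuous_intros spline_entry_right_continuous)
    then have "c i = 0" if "i < n" for i using that by (rule spline_entry_independent)
    then show False using assms by blast
  qed
  ultimately show ?thesis
    unfolding expectation_spline_entry_bilinear by simp
qed

abbreviation \<psi> :: "nat \<Rightarrow> real \<Rightarrow> real" where
  "\<psi> \<equiv> orthonormal_spline M Z p n \<xi>"

definition Q :: "real Matrix.mat" where
  "Q = cholesky_factor (spline_gram M Z p n \<xi>)"

definition Q_inv :: "real Matrix.mat" where
  "Q_inv = the (mat_inverse Q)"

lemma spline_vec_index: "i < n \<Longrightarrow> vec_index (spline_vec p n \<xi> x) i = spline_entry i x"
  by (simp add: spline_vec_def spline_entry_def)

lemma spline_gram_eq: "spline_gram M Z p n \<xi> = Matrix.mat n n (\<lambda>(i, j). gram i j)"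
  by (auto simp: spline_gram_def gram_def spline_vec_index intro!: eq_matI)

lemma Q_props:
  "Q \<in> carrier_mat n n" "\<And>i j. i < j \<Longrightarrow> j < n \<Longrightarrow> Q $$ (i, j) = 0"
  "\<And>i. i < n \<Longrightarrow> 0 < Q $$ (i, i)" "Q * transpose_mat Q = Matrix.mat n n (\<lambda>(i, j). gram i j)"
  unfolding Q_def spline_gram_eq
  by (rule cholesky_factor_mat[of n gram, OF gram_commute gram_pos_def]; assumption)+

lemma Q_inv_props: "Q_inv \<in> carrier_mat n n" "Q_inv * Q = 1\<^sub>m n" "Q * Q_inv = 1\<^sub>m n"
  unfolding Q_inv_def by (rule lower_triangular_mat_inverse[OF Q_props(1-3)]; assumption)+

lemma \<psi>_Suc: "i < n \<Longrightarrow> \<psi> (Suc i) x = (\<Sum>j<n. Q_inv $$ (i, j) * spline_entry j x)"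
  using Q_inv_props(1)
  by (auto simp: orthonormal_spline_def Q_def[symmetric] Q_inv_def[symmetric] scalar_prod_def
      spline_vec_def atLeast0LessThan spline_entry_def intro!: sum.cong)

lemma spline_entry_eq_sum_\<psi>:
  assumes "i < n"
  shows "spline_entry i x = (\<Sum>l<n. Q $$ (i, l) * \<psi> (Suc l) x)"
proof -
  have "(\<Sum>l<n. Q $$ (i, l) * Q_inv $$ (l, j)) = (if i = j then 1 else 0)" if "j < n" for j
  proof -
    have "(Q * Q_inv) $$ (i, j) = (\<Sum>l<n. Q $$ (i, l) * Q_inv $$ (l, j))"
      using Q_props(1) Q_inv_props(1) assms that by (simp add: scalar_prod_def atLeast0LessThan)
    then show ?thesis using Q_inv_props(3) assms that by simp
  qed
  note Q_Q_inv = this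
  have "(\<Sum>l<n. Q $$ (i, l) * \<psi> (Suc l) x) = (\<Sum>l<n. \<Sum>j<n. Q $$ (i, l) * Q_inv $$ (l, j) * spline_entry j x)"
    by (simp add: \<psi>_Suc sum_distrib_left mult.assoc)
  also have "\<dots> = (\<Sum>j<n. (\<Sum>l<n. Q $$ (i, l) * Q_inv $$ (l, j)) * spline_entry j x)"
    by (subst sum.swap) (simp add: sum_distrib_right)
  also have "\<dots> = (\<Sum>j<n. (if i = j then spline_entry j x else 0))"
    by (intro sum.cong) (simp_all add: Q_Q_inv)
  also have "\<dots> = spline_entry i x" using assms by simp
  finally show ?thesis by simp
qed

text \<open>
  The first row of \<open>Q\<close> is zero off the diagonal, and its diagonal entry squares to \<open>E[1 * 1] = 1\<close>.
\<close>

lemma \<psi>_1: "\<psi> 1 x = 1"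
proof -
  have 0: "spline_entry 0 t = Q $$ (0, 0) * \<psi> 1 t" for t
  proof -
    have "spline_entry 0 t = (\<Sum>l<n. Q $$ (0, l) * \<psi> (Suc l) t)" by (rule spline_entry_eq_sum_\<psi>[OF n_pos])
    also have "\<dots> = (\<Sum>l<n. if l = 0 then Q $$ (0, 0) * \<psi> 1 t else 0)"
      by (intro sum.cong) (auto simp: Q_props(2))
    finally show ?thesis using n_pos by simp
  qed
  have "(Q * transpose_mat Q) $$ (0, 0) = (\<Sum>k<n. Q $$ (0, k) * Q $$ (0, k))"
    using Q_props(1) n_pos by (simp add: scalar_prod_def atLeast0LessThan)
  also have "\<dots> = (\<Sum>k<n. if k = 0 then Q $$ (0, 0) * Q $$ (0, 0) else 0)"
    by (intro sum.cong) (auto simp: Q_props(2))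
  also have "\<dots> = Q $$ (0, 0) * Q $$ (0, 0)" using n_pos by simp
  finally have "Q $$ (0, 0) * Q $$ (0, 0) = gram 0 0"
    using n_pos by (simp add: Q_props(4))
  also have "gram 0 0 = 1"
    by (simp add: gram_def spline_entry_def prob_space)
  finally have "Q $$ (0, 0) = 1"
    using Q_props(3)[OF n_pos] by (simp add: square_eq_1_iff)
  then show ?thesis using 0[of x] by (simp add: spline_entry_def)
qed

lemma \<psi>_orthonormal:
  assumes "i \<in> {1..n}" "j \<in> {1..n}"
  shows "expectation (\<lambda>\<omega>. \<psi> i (Z \<omega>) * \<psi> j (Z \<omega>)) = (if i = j then 1 else 0)"
proof -
  obtain k l where kl: "i = Suc k" "j = Suc l" "k < n" "l < n"
    using assms by (cases i; cases j) auto
  let ?G = "Matrix.mat n n (\<lambda>(i, j). gram i j)"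
  have "Q_inv * ?G * transpose_mat Q_inv = (Q_inv * Q) * (transpose_mat Q * transpose_mat Q_inv)"
    unfolding Q_props(4)[symmetric] using Q_props(1) Q_inv_props(1)
    by (simp add: assoc_mult_mat[of _ n n _ n _ n])
  also have "\<dots> = (Q_inv * Q) * transpose_mat (Q_inv * Q)"
    using Q_props(1) Q_inv_props(1) by (simp add: transpose_mult)
  also have "\<dots> = 1\<^sub>m n" by (simp add: Q_inv_props)
  finally have inv_G_inv: "Q_inv * ?G * transpose_mat Q_inv = 1\<^sub>m n" .
  have "expectation (\<lambda>\<omega>. \<psi> i (Z \<omega>) * \<psi> j (Z \<omega>)) = (\<Sum>r<n. \<Sum>s<n. Q_inv $$ (k, r) * Q_inv $$ (l, s) * gram r s)"
    using expectation_spline_entry_bilinear kl by (simp add: \<psi>_Suc)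
  also have "\<dots> = (\<Sum>s<n. \<Sum>r<n. Q_inv $$ (k, r) * Q_inv $$ (l, s) * gram r s)"
    by (rule sum.swap)
  also have "\<dots> = (Q_inv * ?G * transpose_mat Q_inv) $$ (k, l)"
    using Q_inv_props(1) kl
    by (auto simp: scalar_prod_def atLeast0LessThan sum_distrib_left sum_distrib_right mult_ac intro!: sum.cong)
  also have "\<dots> = (if i = j then 1 else 0)" unfolding inv_G_inv using kl by simp
  finally show ?thesis .
qed

lemma \<psi>_measurable: "i \<in> {1..n} \<Longrightarrow> \<psi> i \<in> borel_measurable borel"
proof -
  assume "i \<in> {1..n}"
  then obtain k where "i = Suc k" "k < n" by (cases i) auto
  then have "\<psi> i = (\<lambda>x. \<Sum>j<n. Q_inv $$ (k, j) * spline_entry j x)" by (simp add: fun_eq_iff \<psi>_Suc)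
  then show ?thesis by simp
qed

lemma \<psi>_bounded: "i \<in> {1..n} \<Longrightarrow> \<exists>C. \<forall>x\<in>{a..b}. \<bar>\<psi> i x\<bar> \<le> C"
  using bounded_sum_spline_entry by (cases i) (simp_all add: \<psi>_Suc)

lemma spline_entry_on_half_open:
  assumes "i < n"
  shows "\<exists>\<phi>\<in>spline_space p n \<xi>. \<forall>x\<in>{a..<b}. spline_entry i x = \<phi> x"
proof (cases "i = 0")
  case True
  have "(\<lambda>x. \<Sum>j = 1..n. 1 * bspline \<xi> p j x) \<in> spline_space p n \<xi>"
    unfolding spline_space_def by (intro sum_in_span fun_space.span_base) simp
  then show ?thesis
    using sum_bspline_eq_1[OF knots] True by (intro bexI) (auto simp: spline_entry_def)
next
  case False
  have "bspline \<xi> p (i + 1) \<in> spline_space p n \<xi>"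
    unfolding spline_space_def using assms by (intro fun_space.span_base) simp
  then show ?thesis
    using False by (intro bexI) (auto simp: spline_entry_def)
qed

lemma \<psi>_on_half_open:
  assumes "i \<in> {1..n}"
  shows "\<exists>\<phi>\<in>spline_space p n \<xi>. \<forall>x\<in>{a..<b}. \<psi> i x = \<phi> x"
proof -
  obtain \<phi> where \<phi>: "\<And>j. j < n \<Longrightarrow> \<phi> j \<in> spline_space p n \<xi>" "\<And>j x. j < n \<Longrightarrow> x \<in> {a..<b} \<Longrightarrow> spline_entry j x = \<phi> j x"
    using spline_entry_on_half_open by metis
  obtain k where k: "i = Suc k" "k < n" using assms by (cases i) auto
  have "(\<lambda>x. \<Sum>j<n. Q_inv $$ (k, j) * \<phi> j x) \<in> spline_space p n \<xi>"
    using \<phi>(1) unfolding spline_space_def by (intro sum_in_span) simp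
  moreover have "\<forall>x\<in>{a..<b}. \<psi> i x = (\<Sum>j<n. Q_inv $$ (k, j) * \<phi> j x)"
    using k \<phi>(2) by (simp add: \<psi>_Suc)
  ultimately show ?thesis by (intro bexI[of _ "\<lambda>x. \<Sum>j<n. Q_inv $$ (k, j) * \<phi> j x"])
qed

text \<open>
  The matrix \<open>Q\<close> expresses the entries of the vector in the orthonormal functions. This covers all B-splines
  except the first one, which on \<open>{a..<b}\<close> is \<open>1\<close> minus the others.
\<close>

lemma spline_space_expansion:
  assumes "g \<in> spline_space p n \<xi>"
  shows "\<exists>d. \<forall>x\<in>{a..<b}. g x = (\<Sum>i = 1..n. d i * \<psi> i x)"
proof -
  let ?T = "{g. \<exists>d. \<forall>x\<in>{a..<b}. g x = (\<Sum>i = 1..n. d i * \<psi> i x)}"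
  have "bspline \<xi> p j \<in> ?T" if j: "j \<in> {1..n}" for j
  proof (cases "j = 1")
    case True
    have "bspline \<xi> p 1 x = (\<Sum>l<n. (Q $$ (0, l) - (\<Sum>i\<in>{1..<n}. Q $$ (i, l))) * \<psi> (Suc l) x)"
      if "x \<in> {a..<b}" for x
    proof -
      have "(\<Sum>i\<in>{1..<n}. spline_entry i x) = (\<Sum>i\<in>{1..<n}. \<Sum>l<n. Q $$ (i, l) * \<psi> (Suc l) x)"
        by (intro sum.cong refl spline_entry_eq_sum_\<psi>) simp
      also have "\<dots> = (\<Sum>l<n. (\<Sum>i\<in>{1..<n}. Q $$ (i, l)) * \<psi> (Suc l) x)"
        by (subst sum.swap) (simp add: sum_distrib_right)
      finally show ?thesis
        unfolding bspline_1_eq[OF that] spline_entry_eq_sum_\<psi>[OF n_pos]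
        by (simp add: left_diff_distrib sum_subtractf)
    qed
    then show ?thesis
      unfolding True
      by (auto simp: sum.atLeast1_atMost_eq intro!: exI[of _ "\<lambda>i. Q $$ (0, i - 1) - (\<Sum>j\<in>{1..<n}. Q $$ (j, i - 1))"])
  next
    case False
    then obtain k where k: "j = Suc k" "0 < k" "k < n" using j by (cases j) auto
    have "bspline \<xi> p j x = (\<Sum>l<n. Q $$ (k, l) * \<psi> (Suc l) x)" for x
      using spline_entry_eq_sum_\<psi>[OF k(3)] k by (simp add: spline_entry_def)
    then show ?thesis
      by (auto simp: sum.atLeast1_atMost_eq intro!: exI[of _ "\<lambda>i. Q $$ (k, i - 1)"])
  qed
  then have "spline_space p n \<xi> \<subseteq> ?T"
    unfolding spline_space_def by (intro fun_space.span_minimal subspace_sums_on) auto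
  then show ?thesis using assms by blast
qed

end

section \<open>Joint density of independent components\<close>

lemma borel_measurable_vec_nth_real [measurable]: "(\<lambda>x::real^'n::finite. x $ k) \<in> borel_measurable borel"
  by (intro borel_measurable_continuous_onI continuous_intros)

lemma bij_betw_axis_Basis: "bij_betw (\<lambda>k. axis k 1) UNIV (Basis :: (real^'n::finite) set)"
  by (auto simp: bij_betw_def inj_on_def axis_eq_axis Basis_vec_def)

lemma nn_integral_lborel_vec_prod:
  fixes g :: "'n::finite \<Rightarrow> real \<Rightarrow> ennreal"
  assumes [measurable]: "\<And>k. g k \<in> borel_measurable borel"
  shows "(\<integral>\<^sup>+x. (\<Prod>k\<in>UNIV. g k (x $ k)) \<partial>(lborel :: (real^'n) measure)) = (\<Prod>k\<in>UNIV. \<integral>\<^sup>+t. g k t \<partial>lborel)"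
proof -
  have "(\<Prod>k\<in>UNIV. g k (x $ k)) = (\<Prod>b\<in>Basis. g (axis_index b) (x \<bullet> b))" for x :: "real^'n"
    by (subst prod.reindex_bij_betw[OF bij_betw_axis_Basis, symmetric])
       (simp add: axis_index_axis inner_axis)
  moreover have "(\<Prod>k\<in>UNIV. \<integral>\<^sup>+t. g k t \<partial>lborel)
      = (\<Prod>b\<in>(Basis :: (real^'n) set). \<integral>\<^sup>+t. g (axis_index b) t \<partial>lborel)"
    by (subst prod.reindex_bij_betw[OF bij_betw_axis_Basis, symmetric]) (simp add: axis_index_axis)
  ultimately show ?thesis
    using nn_integral_lborel_prod[of "\<lambda>b::real^'n. g (axis_index b)"] by simp
qed

text \<open>
  It is enough to compare the two measures on open boxes. The indicator function of a box is a product of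
  functions of one coordinate each, so both integrals of it split: the one under the law of \<open>X\<close> by independence,
  the one under the density by Tonelli's theorem.
\<close>

lemma (in prob_space) indep_components_joint_density:
  fixes X :: "'a \<Rightarrow> real^'n::finite" and f :: "'n \<Rightarrow> real \<Rightarrow> real"
  assumes X [measurable]: "X \<in> borel_measurable M"
    and indep: "indep_vars (\<lambda>_. borel) (\<lambda>k \<omega>. X \<omega> $ k) UNIV"
    and dens: "\<And>k. distributed M lborel (\<lambda>\<omega>. X \<omega> $ k) (\<lambda>t. ennreal (f k t))"
    and nonneg: "\<And>k t. 0 \<le> f k t"
  shows "distr M borel X = density lborel (\<lambda>x. ennreal (\<Prod>k\<in>UNIV. f k (x $ k)))"
proof (rule measure_eqI_generator_eq)
  let ?E = "range (\<lambda>(a, b). box a b :: (real^'n) set)"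
  have f [measurable]: "f k \<in> borel_measurable borel" for k
    using distributed_real_measurable[OF _ dens[of k]] nonneg by simp
  interpret D: prob_space "distr M borel X" by (rule prob_space_distr) simp
  show "Int_stable ?E" by (auto simp: Int_stable_def box_Int_box)
  show "?E \<subseteq> Pow UNIV" "sets (distr M borel X) = sigma_sets UNIV ?E"
    "sets (density lborel (\<lambda>x. ennreal (\<Prod>k\<in>UNIV. f k (x $ k)))) = sigma_sets UNIV ?E"
    by (simp_all add: borel_eq_box)
  let ?A = "\<lambda>n::nat. box (- (real n *\<^sub>R One)) (real n *\<^sub>R One) :: (real^'n) set"
  show "range ?A \<subseteq> ?E" "(\<Union>i. ?A i) = UNIV"
    unfolding UN_box_eq_UNIV by auto
  show "emeasure (distr M borel X) (?A i) \<noteq> \<infinity>" for i by simp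
  fix B :: "(real^'n) set" assume "B \<in> ?E"
  then obtain l u where B: "B = box l u" by auto
  define I where "I k t = (indicator {l $ k<..<u $ k} t :: ennreal)" for k t
  have [measurable]: "I k \<in> borel_measurable borel" for k unfolding I_def by simp
  have ind: "indicator B x = (\<Prod>k\<in>UNIV. I k (x $ k))" for x
  proof (cases "x \<in> B")
    case True
    then show ?thesis by (simp add: I_def B mem_box_cart)
  next
    case False
    then obtain k where "x $ k \<notin> {l $ k<..<u $ k}" by (auto simp: B mem_box_cart)
    then have "I k (x $ k) = 0" by (simp add: I_def)
    then have "(\<Prod>k\<in>UNIV. I k (x $ k)) = 0" by (intro prod_zero) auto
    then show ?thesis using False by simp
  qed
  have "emeasure (distr M borel X) B = (\<integral>\<^sup>+x. indicator B x \<partial>distr M borel X)"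
    by (simp add: B)
  also have "\<dots> = (\<integral>\<^sup>+\<omega>. (\<Prod>k\<in>UNIV. I k (X \<omega> $ k)) \<partial>M)"
    unfolding ind by (subst nn_integral_distr) auto
  also have "\<dots> = (\<Prod>k\<in>UNIV. \<integral>\<^sup>+\<omega>. I k (X \<omega> $ k) \<partial>M)"
    by (intro indep_vars_nn_integral indep_vars_compose2[OF indep]) auto
  also have "\<dots> = (\<Prod>k\<in>UNIV. \<integral>\<^sup>+t. ennreal (f k t) * I k t \<partial>lborel)"
    by (intro prod.cong refl distributed_nn_integral[OF dens, symmetric]) simp
  also have "\<dots> = (\<integral>\<^sup>+x. (\<Prod>k\<in>UNIV. ennreal (f k (x $ k)) * I k (x $ k)) \<partial>lborel)"
    by (subst nn_integral_lborel_vec_prod) auto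
  also have "\<dots> = (\<integral>\<^sup>+x. ennreal (\<Prod>k\<in>UNIV. f k (x $ k)) * indicator B x \<partial>lborel)"
    unfolding ind prod.distrib by (simp add: prod_ennreal nonneg)
  also have "\<dots> = emeasure (density lborel (\<lambda>x. ennreal (\<Prod>k\<in>UNIV. f k (x $ k)))) B"
    by (subst emeasure_density) (auto simp: B)
  finally show "emeasure (distr M borel X) B = emeasure (density lborel (\<lambda>x. ennreal (\<Prod>k\<in>UNIV. f k (x $ k)))) B" .
qed

section \<open>Projection onto tensor-product splines\<close>

text \<open>
  Completing the square in each coefficient: the error is smallest at the Fourier coefficients.
\<close>

lemma square_error_orthonormal_expansion:
  fixes Y :: "'w \<Rightarrow> real" and e :: "'i \<Rightarrow> 'w \<Rightarrow> real"
  assumes "finite J" and Y: "integrable M (\<lambda>\<omega>. (Y \<omega>)\<^sup>2)"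
    and Ye: "\<And>j. j \<in> J \<Longrightarrow> integrable M (\<lambda>\<omega>. Y \<omega> * e j \<omega>)"
    and ee: "\<And>i j. i \<in> J \<Longrightarrow> j \<in> J \<Longrightarrow> integrable M (\<lambda>\<omega>. e i \<omega> * e j \<omega>)"
    and orth: "\<And>i j. i \<in> J \<Longrightarrow> j \<in> J \<Longrightarrow> integral\<^sup>L M (\<lambda>\<omega>. e i \<omega> * e j \<omega>) = (if i = j then 1 else 0)"
  shows "integral\<^sup>L M (\<lambda>\<omega>. (Y \<omega> - (\<Sum>j\<in>J. d j * e j \<omega>))\<^sup>2) =
    integral\<^sup>L M (\<lambda>\<omega>. (Y \<omega>)\<^sup>2) - (\<Sum>j\<in>J. (integral\<^sup>L M (\<lambda>\<omega>. Y \<omega> * e j \<omega>))\<^sup>2)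
      + (\<Sum>j\<in>J. (d j - integral\<^sup>L M (\<lambda>\<omega>. Y \<omega> * e j \<omega>))\<^sup>2)"
proof -
  let ?c = "\<lambda>j. integral\<^sup>L M (\<lambda>\<omega>. Y \<omega> * e j \<omega>)"
  have "(Y \<omega> - (\<Sum>j\<in>J. d j * e j \<omega>))\<^sup>2 = (Y \<omega>)\<^sup>2 - 2 * (\<Sum>j\<in>J. d j * (Y \<omega> * e j \<omega>))
      + (\<Sum>i\<in>J. \<Sum>j\<in>J. d i * d j * (e i \<omega> * e j \<omega>))" for \<omega>
  proof -
    have "(\<Sum>i\<in>J. \<Sum>j\<in>J. d i * d j * (e i \<omega> * e j \<omega>)) = (\<Sum>j\<in>J. d j * e j \<omega>) * (\<Sum>j\<in>J. d j * e j \<omega>)"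
      unfolding sum_product by (intro sum.cong refl) simp
    moreover have "(\<Sum>j\<in>J. d j * (Y \<omega> * e j \<omega>)) = Y \<omega> * (\<Sum>j\<in>J. d j * e j \<omega>)"
      unfolding sum_distrib_left by (intro sum.cong refl) simp
    ultimately show ?thesis by (simp add: power2_eq_square algebra_simps)
  qed
  then have "integral\<^sup>L M (\<lambda>\<omega>. (Y \<omega> - (\<Sum>j\<in>J. d j * e j \<omega>))\<^sup>2) = integral\<^sup>L M (\<lambda>\<omega>. (Y \<omega>)\<^sup>2)
     - 2 * (\<Sum>j\<in>J. d j * ?c j) + (\<Sum>i\<in>J. \<Sum>j\<in>J. d i * d j * integral\<^sup>L M (\<lambda>\<omega>. e i \<omega> * e j \<omega>))"
    using Y Ye ee by (simp add: integrable_sum)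
  also have "(\<Sum>i\<in>J. \<Sum>j\<in>J. d i * d j * integral\<^sup>L M (\<lambda>\<omega>. e i \<omega> * e j \<omega>)) = (\<Sum>i\<in>J. (d i)\<^sup>2)"
  proof (intro sum.cong refl)
    fix i assume i: "i \<in> J"
    have "(\<Sum>j\<in>J. d i * d j * integral\<^sup>L M (\<lambda>\<omega>. e i \<omega> * e j \<omega>)) = (\<Sum>j\<in>J. if i = j then (d i)\<^sup>2 else 0)"
      using i by (intro sum.cong refl) (auto simp: orth power2_eq_square)
    then show "(\<Sum>j\<in>J. d i * d j * integral\<^sup>L M (\<lambda>\<omega>. e i \<omega> * e j \<omega>)) = (d i)\<^sup>2"
      using i \<open>finite J\<close> by simp
  qed
  also have "integral\<^sup>L M (\<lambda>\<omega>. (Y \<omega>)\<^sup>2) - 2 * (\<Sum>j\<in>J. d j * ?c j) + (\<Sum>i\<in>J. (d i)\<^sup>2) =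
    integral\<^sup>L M (\<lambda>\<omega>. (Y \<omega>)\<^sup>2) - (\<Sum>j\<in>J. (?c j)\<^sup>2) + (\<Sum>j\<in>J. (d j - ?c j)\<^sup>2)"
    by (simp add: power2_diff sum.distrib sum_subtractf sum_distrib_left mult_ac)
  finally show ?thesis .
qed

lemma AE_lborel_vec_nth_neq: "AE x in (lborel :: (real^'n::finite) measure). x $ k \<noteq> c"
proof -
  have "negligible {x :: real^'n. x \<bullet> axis k 1 = c}"
    by (rule negligible_standard_hyperplane) simp
  then have "{x :: real^'n. x $ k = c} \<in> null_sets lebesgue"
    by (simp add: negligible_iff_null_sets inner_axis)
  moreover have "{x :: real^'n. x $ k = c} \<in> sets lborel" by simp
  ultimately have "{x :: real^'n. x $ k = c} \<in> null_sets lborel"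
    by (simp only: null_sets_completion_iff)
  then show ?thesis using AE_not_in by fastforce
qed

text \<open>
  Every coordinate of the vector is an instance of the previous locale; independence links them.
\<close>

locale spline_vector = prob_space M for M :: "'w measure" +
  fixes X :: "'w \<Rightarrow> real^'n::finite" and a b :: "real^'n" and f :: "'n \<Rightarrow> real \<Rightarrow> real"
    and p n :: "'n \<Rightarrow> nat" and \<xi> :: "'n \<Rightarrow> nat \<Rightarrow> real"
  assumes ab: "\<And>k. a $ k < b $ k"
    and X_meas: "X \<in> measurable M (restrict_space borel (cbox a b))"
    and indep: "indep_vars (\<lambda>_. borel) (\<lambda>k \<omega>. X \<omega> $ k) UNIV"
    and density: "\<And>k. distributed M lborel (\<lambda>\<omega>. X \<omega> $ k) (\<lambda>t. ennreal (f k t))"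
    and f_nonneg: "\<And>k t. 0 \<le> f k t"
    and f_cont: "\<And>k. continuous_on {a $ k..b $ k} (f k)"
    and f_support: "\<And>k. closure {t. f k t \<noteq> 0} = {a $ k..b $ k}"
    and knots: "\<And>k. open_knots (a $ k) (b $ k) (p k) (n k) (\<xi> k)"
begin

lemma X_borel [measurable]: "X \<in> borel_measurable M"
  and X_range: "\<omega> \<in> space M \<Longrightarrow> X \<omega> \<in> cbox a b"
  using X_meas by (auto simp: measurable_restrict_space2_iff)

sublocale coord: spline_variable M "\<lambda>\<omega>. X \<omega> $ k" "f k" "a $ k" "b $ k" "p k" "n k" "\<xi> k" for k
  by unfold_locales (use ab density f_nonneg f_cont f_support knots X_range in \<open>auto simp: mem_box_cart\<close>)

abbreviation "\<psi> k \<equiv> orthonormal_spline M (\<lambda>\<omega>. X \<omega> $ k) (p k) (n k) (\<xi> k)"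

text \<open>
  The set on which the orthonormal products agree exactly with elements of the tensor-product spline space.
\<close>

definition half_open_box :: "(real^'n) set" where
  "half_open_box = {x. \<forall>k. a $ k \<le> x $ k \<and> x $ k < b $ k}"

text \<open>
  All multi-indices, including those with entries \<open>1\<close>; a coordinate with index \<open>1\<close> contributes the
  constant factor \<open>1\<close> to the product.
\<close>

definition indices :: "('n \<Rightarrow> nat) set" where
  "indices = (\<Pi>\<^sub>E k\<in>UNIV. {1..n k})"

definition \<Psi> :: "('n \<Rightarrow> nat) \<Rightarrow> real^'n \<Rightarrow> real" where
  "\<Psi> j x = (\<Prod>k\<in>UNIV. \<psi> k (j k) (x $ k))"

lemma finite_indices: "finite indices"
  unfolding indices_def by (intro finite_PiE) auto

lemma indices_mem: "j \<in> indices \<Longrightarrow> j k \<in> {1..n k}"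
  unfolding indices_def by blast

lemma AE_lborel_half_open_box: "AE x in lborel. x \<in> cbox a b \<longrightarrow> x \<in> half_open_box"
proof -
  have "AE x in (lborel :: (real^'n) measure). \<forall>k\<in>UNIV. x $ k \<noteq> b $ k"
    by (intro AE_finite_allI AE_lborel_vec_nth_neq) simp
  then show ?thesis
    by eventually_elim (auto simp: half_open_box_def mem_box_cart less_le)
qed

lemma distr_X: "distr M borel X = density lborel (\<lambda>x. ennreal (\<Prod>k\<in>UNIV. f k (x $ k)))"
  by (rule indep_components_joint_density[OF X_borel indep density f_nonneg])

lemma f_measurable [measurable]: "f k \<in> borel_measurable borel"
  using distributed_real_measurable[OF _ density[of k]] f_nonneg by simp

lemma AE_X_half_open_box: "AE \<omega> in M. X \<omega> \<in> half_open_box"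
proof -
  have "AE x in density lborel (\<lambda>x. ennreal (\<Prod>k\<in>UNIV. f k (x $ k))). x \<in> cbox a b \<longrightarrow> x \<in> half_open_box"
    using AE_lborel_half_open_box by (subst AE_density) (auto elim: eventually_mono)
  then have "AE \<omega> in M. X \<omega> \<in> cbox a b \<longrightarrow> X \<omega> \<in> half_open_box"
    unfolding distr_X[symmetric] by (rule AE_distrD[rotated]) simp
  then show ?thesis
    using X_range by (auto elim: eventually_mono[rotated] simp: AE_conj_iff intro: AE_mp)
qed

lemma \<Psi>_measurable: "j \<in> indices \<Longrightarrow> \<Psi> j \<in> borel_measurable borel"
  unfolding \<Psi>_def[abs_def]
  by (intro borel_measurable_prod measurable_compose[OF borel_measurable_vec_nth_real] coord.\<psi>_measurable)
     (rule indices_mem)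

lemma \<Psi>_bounded:
  assumes "j \<in> indices"
  shows "\<exists>C. \<forall>x\<in>cbox a b. \<bar>\<Psi> j x\<bar> \<le> C"
proof -
  have "\<exists>C. \<forall>x\<in>{a $ k..b $ k}. \<bar>\<psi> k (j k) x\<bar> \<le> C" for k
    by (rule coord.\<psi>_bounded[OF indices_mem[OF assms]])
  then obtain C where C: "\<And>k x. x \<in> {a $ k..b $ k} \<Longrightarrow> \<bar>\<psi> k (j k) x\<bar> \<le> C k" by metis
  have "\<bar>\<Psi> j x\<bar> \<le> (\<Prod>k\<in>UNIV. C k)" if "x \<in> cbox a b" for x
    unfolding \<Psi>_def abs_prod
    by (intro prod_mono) (use C that in \<open>auto simp: mem_box_cart\<close>)
  then show ?thesis by blast
qed

lemma integrable_mult_\<Psi>: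
  assumes [measurable]: "Y \<in> borel_measurable M" and Y: "integrable M (\<lambda>\<omega>. (Y \<omega>)\<^sup>2)" and j: "j \<in> indices"
  shows "integrable M (\<lambda>\<omega>. Y \<omega> * \<Psi> j (X \<omega>))"
proof -
  obtain C where C: "\<forall>x\<in>cbox a b. \<bar>\<Psi> j x\<bar> \<le> C" using \<Psi>_bounded[OF j] by blast
  note [measurable] = \<Psi>_measurable[OF j]
  show ?thesis
  proof (rule Bochner_Integration.integrable_bound)
    show "integrable M (\<lambda>\<omega>. (Y \<omega>)\<^sup>2 + C\<^sup>2)" using Y by simp
    show "AE \<omega> in M. norm (Y \<omega> * \<Psi> j (X \<omega>)) \<le> norm ((Y \<omega>)\<^sup>2 + C\<^sup>2)"
    proof (rule AE_I2)
      fix \<omega> assume "\<omega> \<in> space M"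
      then have "\<bar>\<Psi> j (X \<omega>)\<bar> \<le> C" using C X_range by blast
      then have "(\<Psi> j (X \<omega>))\<^sup>2 \<le> C\<^sup>2" by (rule power2_le_iff_abs_le[THEN iffD2, rotated]) (use \<open>\<bar>_\<bar> \<le> C\<close> in linarith)
      moreover have "2 * \<bar>Y \<omega> * \<Psi> j (X \<omega>)\<bar> \<le> (Y \<omega>)\<^sup>2 + (\<Psi> j (X \<omega>))\<^sup>2"
        using sum_squares_bound[of "\<bar>Y \<omega>\<bar>" "\<bar>\<Psi> j (X \<omega>)\<bar>"] by (simp add: abs_mult)
      ultimately show "norm (Y \<omega> * \<Psi> j (X \<omega>)) \<le> norm ((Y \<omega>)\<^sup>2 + C\<^sup>2)" by simp
    qed
  qed simp
qed

lemma
  assumes "i \<in> indices" "j \<in> indices"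
  shows integrable_\<Psi>_\<Psi>: "integrable M (\<lambda>\<omega>. \<Psi> i (X \<omega>) * \<Psi> j (X \<omega>))"
    and \<Psi>_orthonormal: "expectation (\<lambda>\<omega>. \<Psi> i (X \<omega>) * \<Psi> j (X \<omega>)) = (if i = j then 1 else 0)"
proof -
  note ij = indices_mem[OF assms(1)] indices_mem[OF assms(2)]
  note [measurable] = coord.\<psi>_measurable[OF ij(1)] coord.\<psi>_measurable[OF ij(2)]
  have eq: "\<Psi> i (X \<omega>) * \<Psi> j (X \<omega>) = (\<Prod>k\<in>UNIV. \<psi> k (i k) (X \<omega> $ k) * \<psi> k (j k) (X \<omega> $ k))" for \<omega>
    by (simp add: \<Psi>_def prod.distrib)
  have ind: "indep_vars (\<lambda>_. borel) (\<lambda>k \<omega>. \<psi> k (i k) (X \<omega> $ k) * \<psi> k (j k) (X \<omega> $ k)) UNIV"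
    by (rule indep_vars_compose2[OF indep]) simp
  have int: "integrable M (\<lambda>\<omega>. \<psi> k (i k) (X \<omega> $ k) * \<psi> k (j k) (X \<omega> $ k))" for k
    by (rule coord.integrable_bounded[where s = "\<lambda>t. \<psi> k (i k) t * \<psi> k (j k) t"])
       (auto intro!: bounded_mult coord.\<psi>_bounded[OF ij(1)] coord.\<psi>_bounded[OF ij(2)])
  show "integrable M (\<lambda>\<omega>. \<Psi> i (X \<omega>) * \<Psi> j (X \<omega>))"
    unfolding eq by (intro indep_vars_integrable ind int) simp
  have "expectation (\<lambda>\<omega>. \<Psi> i (X \<omega>) * \<Psi> j (X \<omega>)) =
      (\<Prod>k\<in>UNIV. expectation (\<lambda>\<omega>. \<psi> k (i k) (X \<omega> $ k) * \<psi> k (j k) (X \<omega> $ k)))"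
    unfolding eq by (intro indep_vars_lebesgue_integral ind int) simp
  also have "\<dots> = (\<Prod>k\<in>UNIV. if i k = j k then 1 else 0)"
    by (intro prod.cong refl coord.\<psi>_orthonormal ij)
  also have "\<dots> = (if i = j then 1 else 0)"
    by (auto simp: fun_eq_iff prod_zero_iff)
  finally show "expectation (\<lambda>\<omega>. \<Psi> i (X \<omega>) * \<Psi> j (X \<omega>)) = (if i = j then 1 else 0)" .
qed

text \<open>
  A multi-index over \<open>u\<close> with entries at least \<open>2\<close> corresponds to the full multi-index that continues it by \<open>1\<close>
  outside \<open>u\<close>; conversely, \<open>u\<close> is the set of coordinates at which the entry differs from \<open>1\<close>. The mean of \<open>y (X \<omega>)\<close>
  is the term of the empty set.
\<close>

lemma sdd_approx_eq:
  "sdd_approx M X p n \<xi> y x = (\<Sum>j\<in>indices. expectation (\<lambda>\<omega>. y (X \<omega>) * \<Psi> j (X \<omega>)) * \<Psi> j x)"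
proof -
  define ext where "ext u i k = (if k \<in> u then i k else (1::nat))" for u :: "'n set" and i k
  have basis: "sdd_basis M X p n \<xi> u i x = \<Psi> (ext u i) x" for u i x
    unfolding sdd_basis_def \<Psi>_def
    by (rule prod.mono_neutral_cong_left) (auto simp: ext_def coord.\<psi>_1[simplified])
  let ?t = "\<lambda>u i. expectation (\<lambda>\<omega>. y (X \<omega>) * \<Psi> (ext u i) (X \<omega>)) * \<Psi> (ext u i) x"
  have "sdd_indices n {} = {\<lambda>_. undefined}" by (simp add: sdd_indices_def)
  moreover have "\<Psi> (ext {} i) x = 1" for i x
    by (simp add: \<Psi>_def ext_def coord.\<psi>_1[simplified])
  ultimately have "sdd_approx M X p n \<xi> y x =
      (\<Sum>i\<in>sdd_indices n {}. ?t {} i) + (\<Sum>u | u \<noteq> {}. \<Sum>i\<in>sdd_indices n u. ?t u i)"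
    by (simp add: sdd_approx_def sdd_coeff_def basis)
  also have "\<dots> = (\<Sum>u\<in>UNIV. \<Sum>i\<in>sdd_indices n u. ?t u i)"
    by (subst sum.remove[of UNIV "{}"]) (auto intro!: sum.cong)
  also have "\<dots> = (\<Sum>(u, i)\<in>Sigma UNIV (sdd_indices n). ?t u i)"
    by (subst sum.Sigma) (auto simp: sdd_indices_def intro: finite_PiE)
  also have "\<dots> = (\<Sum>j\<in>indices. expectation (\<lambda>\<omega>. y (X \<omega>) * \<Psi> j (X \<omega>)) * \<Psi> j x)"
  proof (rule sum.reindex_bij_witness[where j = "\<lambda>(u, i). ext u i"
        and i = "\<lambda>j. ({k. j k \<noteq> 1}, restrict j {k. j k \<noteq> 1})"])
    fix ui assume "ui \<in> Sigma UNIV (sdd_indices n)"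
    then obtain u i where ui: "ui = (u, i)" "i \<in> (\<Pi>\<^sub>E k\<in>u. {2..n k})"
      by (auto simp: sdd_indices_def)
    have i2: "i k \<in> {2..n k}" if "k \<in> u" for k using ui(2) that by (rule PiE_mem)
    have "{k. ext u i k \<noteq> 1} = u" using i2 by (force simp: ext_def)
    moreover have "restrict (ext u i) u = i"
      using ui(2) by (auto simp: fun_eq_iff ext_def restrict_def PiE_def extensional_def)
    ultimately show "(\<lambda>j. ({k. j k \<noteq> 1}, restrict j {k. j k \<noteq> 1})) (case ui of (u, i) \<Rightarrow> ext u i) = ui"
      by (simp add: ui)
    show "(case ui of (u, i) \<Rightarrow> ext u i) \<in> indices"
      using i2 coord.n_pos by (force simp: ui indices_def ext_def Suc_le_eq)
    show "expectation (\<lambda>\<omega>. y (X \<omega>) * \<Psi> (case ui of (u, i) \<Rightarrow> ext u i) (X \<omega>)) *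
        \<Psi> (case ui of (u, i) \<Rightarrow> ext u i) x = (case ui of (u, i) \<Rightarrow> ?t u i)"
      by (simp add: ui)
  next
    fix j assume j: "j \<in> indices"
    show "(case ({k. j k \<noteq> 1}, restrict j {k. j k \<noteq> 1}) of (u, i) \<Rightarrow> ext u i) = j"
      by (auto simp: ext_def fun_eq_iff)
    show "({k. j k \<noteq> 1}, restrict j {k. j k \<noteq> 1}) \<in> Sigma UNIV (sdd_indices n)"
      using indices_mem[OF j] by (force simp: sdd_indices_def)
  qed
  finally show ?thesis .
qed

text \<open>
  Expand each factor of an elementary tensor and multiply out.
\<close>

lemma tensor_spline_space_expansion:
  assumes "g \<in> tensor_spline_space p n \<xi>"
  shows "\<exists>d. \<forall>x\<in>half_open_box. g x = (\<Sum>j\<in>indices. d j * \<Psi> j x)"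
proof -
  let ?T = "{g. \<exists>d. \<forall>x\<in>half_open_box. g x = (\<Sum>j\<in>indices. d j * \<Psi> j x)}"
  have "(\<lambda>x. \<Prod>k\<in>UNIV. g k (x $ k)) \<in> ?T" if "\<forall>k. g k \<in> spline_space (p k) (n k) (\<xi> k)" for g
  proof -
    have "\<exists>d. \<forall>t\<in>{a $ k..<b $ k}. g k t = (\<Sum>i = 1..n k. d i * \<psi> k i t)" for k
      using that by (intro coord.spline_space_expansion) simp
    then obtain d where d: "\<And>k t. t \<in> {a $ k..<b $ k} \<Longrightarrow> g k t = (\<Sum>i = 1..n k. d k i * \<psi> k i t)"
      by metis
    have "(\<Prod>k\<in>UNIV. g k (x $ k)) = (\<Sum>j\<in>indices. (\<Prod>k\<in>UNIV. d k (j k)) * \<Psi> j x)"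
      if x: "x \<in> half_open_box" for x
    proof -
      have "(\<Prod>k\<in>UNIV. g k (x $ k)) = (\<Prod>k\<in>UNIV. \<Sum>i = 1..n k. d k i * \<psi> k i (x $ k))"
        using x by (intro prod.cong refl d) (simp add: half_open_box_def)
      also have "\<dots> = (\<Sum>j\<in>indices. \<Prod>k\<in>UNIV. d k (j k) * \<psi> k (j k) (x $ k))"
        unfolding indices_def by (rule prod_sum_PiE) auto
      finally show ?thesis by (simp add: \<Psi>_def prod.distrib)
    qed
    then show ?thesis by (auto intro!: exI[of _ "\<lambda>j. \<Prod>k\<in>UNIV. d k (j k)"])
  qed
  then have "tensor_spline_space p n \<xi> \<subseteq> ?T"
    unfolding tensor_spline_space_def by (intro fun_space.span_minimal subspace_sums_on) auto
  then show ?thesis using assms by blast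
qed

lemma \<Psi>_on_half_open_box:
  assumes "j \<in> indices"
  shows "\<exists>h\<in>tensor_spline_space p n \<xi>. \<forall>x\<in>half_open_box. \<Psi> j x = h x"
proof -
  have "\<exists>\<phi>. \<phi> \<in> spline_space (p k) (n k) (\<xi> k) \<and> (\<forall>t\<in>{a $ k..<b $ k}. \<psi> k (j k) t = \<phi> t)" for k
    using coord.\<psi>_on_half_open[OF indices_mem[OF assms]] by blast
  then obtain \<phi> where \<phi>: "\<And>k. \<phi> k \<in> spline_space (p k) (n k) (\<xi> k)"
    "\<And>k t. t \<in> {a $ k..<b $ k} \<Longrightarrow> \<psi> k (j k) t = \<phi> k t" by metis
  have "(\<lambda>x. \<Prod>k\<in>UNIV. \<phi> k (x $ k)) \<in> tensor_spline_space p n \<xi>"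
    unfolding tensor_spline_space_def using \<phi>(1) by (intro fun_space.span_base) blast
  moreover have "\<forall>x\<in>half_open_box. \<Psi> j x = (\<Prod>k\<in>UNIV. \<phi> k (x $ k))"
    using \<phi>(2) by (auto simp: \<Psi>_def half_open_box_def intro!: prod.cong)
  ultimately show ?thesis by (intro bexI[of _ "\<lambda>x. \<Prod>k\<in>UNIV. \<phi> k (x $ k)"])
qed

lemma sum_\<Psi>_on_half_open_box:
  "\<exists>h\<in>tensor_spline_space p n \<xi>. \<forall>x\<in>half_open_box. (\<Sum>j\<in>indices. d j * \<Psi> j x) = h x"
proof -
  obtain h where h: "\<And>j. j \<in> indices \<Longrightarrow> h j \<in> tensor_spline_space p n \<xi>"
    "\<And>j x. j \<in> indices \<Longrightarrow> x \<in> half_open_box \<Longrightarrow> \<Psi> j x = h j x"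
    using \<Psi>_on_half_open_box by metis
  have "(\<lambda>x. \<Sum>j\<in>indices. d j * h j x) \<in> tensor_spline_space p n \<xi>"
    using h(1) unfolding tensor_spline_space_def by (intro sum_in_span)
  moreover have "\<forall>x\<in>half_open_box. (\<Sum>j\<in>indices. d j * \<Psi> j x) = (\<Sum>j\<in>indices. d j * h j x)"
    using h(2) by (auto intro!: sum.cong)
  ultimately show ?thesis by (intro bexI[of _ "\<lambda>x. \<Sum>j\<in>indices. d j * h j x"])
qed

lemma tensor_spline_measurable:
  assumes "g \<in> tensor_spline_space p n \<xi>"
  shows "g \<in> borel_measurable borel"
proof -
  have uni: "fun_space.subspace (borel_measurable borel :: (real \<Rightarrow> real) set)"
    and multi: "fun_space.subspace (borel_measurable borel :: (real^'n \<Rightarrow> real) set)"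
    by (auto simp: fun_space.subspace_def plus_fun_def zero_fun_def)
  have "spline_space (p k) (n k) (\<xi> k) \<subseteq> borel_measurable borel" for k
    unfolding spline_space_def by (intro fun_space.span_minimal uni) auto
  then have "tensor_spline_space p n \<xi> \<subseteq> borel_measurable borel"
    unfolding tensor_spline_space_def
    by (intro fun_space.span_minimal multi)
       (auto intro!: borel_measurable_prod measurable_compose[OF borel_measurable_vec_nth_real])
  then show ?thesis using assms by blast
qed

lemma weighted_L2_norm_eq:
  assumes h: "h \<in> borel_measurable (restrict_space borel (cbox a b))"
  shows "weighted_L2_norm (cbox a b) (\<lambda>x. \<Prod>k\<in>UNIV. f k (x $ k)) h = sqrt (expectation (\<lambda>\<omega>. (h (X \<omega>))\<^sup>2))"
proof -
  let ?w = "\<lambda>x :: real^'n. \<Prod>k\<in>UNIV. f k (x $ k)"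
  define h' where "h' x = indicator (cbox a b) x *\<^sub>R h x" for x
  have [measurable]: "h' \<in> borel_measurable borel"
    using h unfolding h'_def by (subst (asm) borel_measurable_restrict_space_iff) auto
  have "(LINT x:cbox a b|lborel. \<bar>h x\<bar>\<^sup>2 * ?w x) = (LINT x|lborel. ?w x *\<^sub>R (h' x)\<^sup>2)"
    unfolding set_lebesgue_integral_def h'_def
    by (intro Bochner_Integration.integral_cong refl) (auto simp: indicator_def)
  also have "\<dots> = integral\<^sup>L (density lborel ?w) (\<lambda>x. (h' x)\<^sup>2)"
    by (subst integral_density) (auto intro!: prod_nonneg f_nonneg)
  also have "\<dots> = expectation (\<lambda>\<omega>. (h' (X \<omega>))\<^sup>2)"
    unfolding distr_X[symmetric] by (subst integral_distr) auto
  also have "\<dots> = expectation (\<lambda>\<omega>. (h (X \<omega>))\<^sup>2)"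
    by (intro Bochner_Integration.integral_cong refl) (simp add: h'_def X_range)
  finally show ?thesis by (simp add: weighted_L2_norm_def)
qed

lemma expectation_cong_half_open_box:
  fixes y g h :: "real^'n \<Rightarrow> real"
  assumes [measurable]: "(\<lambda>\<omega>. y (X \<omega>)) \<in> borel_measurable M" "g \<in> borel_measurable borel" "h \<in> borel_measurable borel"
    and eq: "\<And>x. x \<in> half_open_box \<Longrightarrow> g x = h x"
  shows "expectation (\<lambda>\<omega>. (y (X \<omega>) - g (X \<omega>))\<^sup>2) = expectation (\<lambda>\<omega>. (y (X \<omega>) - h (X \<omega>))\<^sup>2)"
  using AE_X_half_open_box eq by (intro integral_cong_AE) (auto elim!: eventually_mono)

lemma sdd_approx_measurable: "sdd_approx M X p n \<xi> y \<in> borel_measurable borel"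
  unfolding sdd_approx_eq[abs_def] by (intro borel_measurable_sum borel_measurable_times \<Psi>_measurable) auto

lemma sdd_approx_optimal:
  assumes y: "(\<lambda>\<omega>. y (X \<omega>)) \<in> borel_measurable M" "integrable M (\<lambda>\<omega>. (y (X \<omega>))\<^sup>2)"
    and g: "g \<in> tensor_spline_space p n \<xi>"
  shows "expectation (\<lambda>\<omega>. (y (X \<omega>) - sdd_approx M X p n \<xi> y (X \<omega>))\<^sup>2)
    \<le> expectation (\<lambda>\<omega>. (y (X \<omega>) - g (X \<omega>))\<^sup>2)"
proof -
  obtain d where d: "\<forall>x\<in>half_open_box. g x = (\<Sum>j\<in>indices. d j * \<Psi> j x)"
    using tensor_spline_space_expansion[OF g] by blast
  have meas: "(\<lambda>x. \<Sum>j\<in>indices. d j * \<Psi> j x) \<in> borel_measurable borel"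
    by (intro borel_measurable_sum borel_measurable_times \<Psi>_measurable) auto
  let ?c = "\<lambda>j. expectation (\<lambda>\<omega>. y (X \<omega>) * \<Psi> j (X \<omega>))"
  have expand: "expectation (\<lambda>\<omega>. (y (X \<omega>) - (\<Sum>j\<in>indices. e j * \<Psi> j (X \<omega>)))\<^sup>2) =
    expectation (\<lambda>\<omega>. (y (X \<omega>))\<^sup>2) - (\<Sum>j\<in>indices. (?c j)\<^sup>2) + (\<Sum>j\<in>indices. (e j - ?c j)\<^sup>2)" for e
    by (intro square_error_orthonormal_expansion finite_indices y integrable_mult_\<Psi>
        integrable_\<Psi>_\<Psi> \<Psi>_orthonormal)
  have "expectation (\<lambda>\<omega>. (y (X \<omega>) - sdd_approx M X p n \<xi> y (X \<omega>))\<^sup>2)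
      \<le> expectation (\<lambda>\<omega>. (y (X \<omega>) - (\<Sum>j\<in>indices. d j * \<Psi> j (X \<omega>)))\<^sup>2)"
    unfolding sdd_approx_eq expand by (simp add: sum_nonneg)
  also have "\<dots> = expectation (\<lambda>\<omega>. (y (X \<omega>) - g (X \<omega>))\<^sup>2)"
    by (rule expectation_cong_half_open_box[symmetric, OF y(1) tensor_spline_measurable[OF g] meas])
       (use d in blast)
  finally show ?thesis .
qed

end

section \<open>Optimality of the spline dimensional decomposition\<close>

theorem proposition5p2:
  fixes M :: "'w measure"
    and X :: "'w \<Rightarrow> real^'n::finite"
    and a b :: "real^'n"
    and f :: "'n \<Rightarrow> real \<Rightarrow> real"
    and p n :: "'n \<Rightarrow> nat"
    and \<xi> :: "'n \<Rightarrow> nat \<Rightarrow> real"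
    and y :: "real^'n \<Rightarrow> real"
  assumes "prob_space M"
    and "\<forall>k. a $ k < b $ k"
    and "X \<in> measurable M (restrict_space borel (cbox a b))"
    and "prob_space.indep_vars M (\<lambda>_. borel) (\<lambda>k \<omega>. X \<omega> $ k) UNIV"
    and "\<forall>k. distributed M lborel (\<lambda>\<omega>. X \<omega> $ k) (\<lambda>t. ennreal (f k t))"
    and "\<forall>k t. 0 \<le> f k t"
    and "\<forall>k. continuous_on {a $ k..b $ k} (f k)"
    and "\<forall>k. closure {t. f k t \<noteq> 0} = {a $ k..b $ k}"
    and "\<forall>k. open_knots (a $ k) (b $ k) (p k) (n k) (\<xi> k)"
    and "y \<in> borel_measurable (restrict_space borel (cbox a b))"
    and "integrable M (\<lambda>\<omega>. (y (X \<omega>))\<^sup>2)"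
  defines "S \<equiv> tensor_spline_space p n \<xi>"
    and "y_SDD \<equiv> sdd_approx M X p n \<xi> y"
    and "f_X \<equiv> (\<lambda>x::real^'n. \<Prod>k\<in>UNIV. f k (x $ k))"
  shows "(\<exists>h\<in>S. AE x in lborel. x \<in> cbox a b \<longrightarrow> y_SDD x = h x) \<and>
    integral\<^sup>L M (\<lambda>\<omega>. (y (X \<omega>) - y_SDD (X \<omega>))\<^sup>2) =
      (INF g\<in>S. integral\<^sup>L M (\<lambda>\<omega>. (y (X \<omega>) - g (X \<omega>))\<^sup>2)) \<and>
    weighted_L2_norm (cbox a b) f_X (\<lambda>x. y x - y_SDD x) =
      (INF g\<in>S. weighted_L2_norm (cbox a b) f_X (\<lambda>x. y x - g x))"
proof -
  interpret prob_space M by fact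
  interpret spline_vector M X a b f p n \<xi>
    by unfold_locales (use assms(2-9) in auto)
  let ?E = "\<lambda>g. expectation (\<lambda>\<omega>. (y (X \<omega>) - g (X \<omega>))\<^sup>2)"
  have y: "(\<lambda>\<omega>. y (X \<omega>)) \<in> borel_measurable M"
    by (rule measurable_compose[OF assms(3,10)])
  have y_SDD: "y_SDD \<in> borel_measurable borel"
    unfolding y_SDD_def by (rule sdd_approx_measurable)
  obtain h where h: "h \<in> S" "\<And>x. x \<in> half_open_box \<Longrightarrow> y_SDD x = h x"
    using sum_\<Psi>_on_half_open_box[of "\<lambda>j. expectation (\<lambda>\<omega>. y (X \<omega>) * \<Psi> j (X \<omega>))"]
    unfolding S_def y_SDD_def sdd_approx_eq by blast
  have S_meas: "g \<in> borel_measurable borel" if "g \<in> S" for g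
    using that unfolding S_def by (rule tensor_spline_measurable)
  have Eh: "?E y_SDD = ?E h"
    by (rule expectation_cong_half_open_box[OF y y_SDD S_meas[OF h(1)] h(2)])
  have min: "?E y_SDD \<le> ?E g" if "g \<in> S" for g
    using sdd_approx_optimal[OF y assms(11)] that unfolding S_def y_SDD_def by blast
  have norm: "weighted_L2_norm (cbox a b) f_X (\<lambda>x. y x - g x) = sqrt (?E g)"
    if "g \<in> borel_measurable borel" for g
    unfolding f_X_def
    by (rule weighted_L2_norm_eq) (intro borel_measurable_diff assms(10) measurable_restrict_space1 that)
  have "(INF g\<in>S. ?E g) = ?E y_SDD"
    by (rule cInf_eq_minimum) (use h(1) Eh min in auto)
  moreover have "(INF g\<in>S. weighted_L2_norm (cbox a b) f_X (\<lambda>x. y x - g x)) = sqrt (?E y_SDD)"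
    by (rule cInf_eq_minimum) (use h(1) Eh min in \<open>auto simp: norm S_meas image_iff intro!: bexI[of _ h]\<close>)
  moreover have "AE x in lborel. x \<in> cbox a b \<longrightarrow> y_SDD x = h x"
    using AE_lborel_half_open_box by eventually_elim (simp add: h(2))
  ultimately show ?thesis
    using h(1) norm[OF y_SDD] by auto
qed

end
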